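(* Let $X$ be a Banach function space over the unit circle $\mathbb{T}$. If the Riesz projection $P$ is bounded on $X$, then $X_a=X_b$ and $(X')_a=(X')_b$.
   Context: $\mathbb{T}$ is the unit circle in $\mathbb{C}$ with normalized Lebesgue measure $dm(t)=|dt|/(2\pi)$; $L^p=L^p(\mathbb{T})$ with respect to $m$; $L^0$ is the space of measurable complex-valued functions on $\mathbb{T}$, and $L^0_+$ is the set of measurable functions on $\mathbb{T}$ with values in $[0,\infty]$. $\mathbb{I}_E$ is the indicator function of $E$. A Banach function norm is a mapping $\rho:L^0_+\to[0,\infty]$ such that for all $f,g,f_n\in L^0_+$ ($n\in\mathbb{N}$), all constants $c\ge 0$ and all measurable $E\subset\mathbb{T}$: (A1) $\rho(f)=0\Leftrightarrow f=0$ a.e., $\rho(cf)=c\rho(f)$, $\rho(f+g)\le\rho(f)+\rho(g)$; (A2) $0\le g\le f$ a.e. implies $\rho(g)\le\rho(f)$; (A3) $0\le f_n\uparrow f$ a.e. implies $\rho(f_n)\uparrow\rho(f)$; (A4) $\rho(\mathbb{I}_E)<\infty$; (A5) $\int_E f\,dm\le C_E\,\rho(f)$ with a constant $C_E\in(0,\infty)$ independent of $f$. The Banach function space determined by $\rho$ is $X=\{f\in L^0:\rho(|f|)<\infty\}$ (functions equal a.e. are identified) with norm $\|f\|_X=\rho(|f|)$. The associate space $X'$ is the Banach function space determined by the Banach function norm $\rho'(g)=\sup\{\int_{\mathbb{T}}fg\,dm: f\in L^0_+,\ \rho(f)\le1\}$, $g\in L^0_+$. For a Banach function space $X$: $X_a$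 is the set of all $f\in X$ with absolutely continuous norm, i.e. such that $\|f\mathbb{I}_{\gamma_n}\|_X\to0$ for every sequence $\{\gamma_n\}_{n\in\mathbb{N}}$ of measurable subsets of $\mathbb{T}$ with $\mathbb{I}_{\gamma_n}\to0$ a.e.; $X_b$ is the closure in $X$ of the set of simple functions on $\mathbb{T}$. The Riesz projection is defined for $f\in L^1$ and a.e. $t\in\mathbb{T}$ by $(Pf)(t)=\frac12\big(f(t)+(Sf)(t)\big)$, where $(Sf)(t)=\frac1{\pi i}\,\mathrm{p.v.}\int_{\mathbb{T}}\frac{f(\tau)}{\tau-t}\,d\tau$. "$P$ is bounded on $X$" means that $P$ maps $X$ to $X$ and is a bounded operator there. *)

theory Defs
  imports "HOL-Probability.Probability" "HOL-Complex_Analysis.Complex_Analysis"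
begin

text \<open>Functions on the circle are total functions on \<^typ>\<open>complex\<close>; their values off the unit
  circle never matter, because everything below depends on them only up to equality almost
  everywhere with respect to \<open>circle_measure\<close>.\<close>

text \<open>Normalized Lebesgue measure on the unit circle. The completion makes the measurable sets
  the Lebesgue measurable ones, so functions are measurable as soon as they agree
  almost everywhere with a measurable function.\<close>

definition circle_measure :: "complex measure" where
  "circle_measure =
     completion (distr (uniform_measure lborel {0..<2 * pi}) (restrict_space borel (sphere 0 1)) cis)"

lemma space_circle_measure [simp]: "space circle_measure = sphere 0 1"
  by (simp add: circle_measure_def space_restrict_space)

lemma cis_measurable_circle:
  "cis \<in> measurable (uniform_measure lborel {0..<2 * pi}) (restrict_space borel (sphere 0 1))"
proof -
  have "cis \<in> borel_measurable borel"
    by (intro borel_measurable_continuous_onI continuous_intros)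
  then show ?thesis
    by (intro measurable_restrict_space2) auto
qed

lemma prob_space_circle_measure: "prob_space circle_measure"
proof -
  have "prob_space (uniform_measure lborel {0..<2 * pi})"
    by (intro prob_space_uniform_measure) auto
  then have "prob_space (distr (uniform_measure lborel {0..<2 * pi})
      (restrict_space borel (sphere 0 1)) cis)"
    by (intro prob_space.prob_space_distr cis_measurable_circle)
  then show ?thesis
    unfolding circle_measure_def by (rule prob_space.prob_space_completion)
qed

definition banach_function_norm :: "((complex \<Rightarrow> ennreal) \<Rightarrow> ennreal) \<Rightarrow> bool" where
  "banach_function_norm \<rho> \<longleftrightarrow>
     ((\<forall>f \<in> borel_measurable circle_measure. \<rho> f = 0 \<longleftrightarrow> (AE t in circle_measure. f t = 0)) \<and>
      (\<forall>f \<in> borel_measurable circle_measure. \<forall>c::real. c \<ge> 0 \<longrightarrow>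
         \<rho> (\<lambda>t. ennreal c * f t) = ennreal c * \<rho> f) \<and>
      (\<forall>f \<in> borel_measurable circle_measure. \<forall>g \<in> borel_measurable circle_measure.
         \<rho> (\<lambda>t. f t + g t) \<le> \<rho> f + \<rho> g) \<and>
      (\<forall>f \<in> borel_measurable circle_measure. \<forall>g \<in> borel_measurable circle_measure.
         (AE t in circle_measure. g t \<le> f t) \<longrightarrow> \<rho> g \<le> \<rho> f) \<and>
      (\<forall>F f. (\<forall>n::nat. F n \<in> borel_measurable circle_measure) \<longrightarrow>
         f \<in> borel_measurable circle_measure \<longrightarrow>
         (AE t in circle_measure. incseq (\<lambda>n. F n t) \<and> (\<lambda>n. F n t) \<longlonglongrightarrow> f t) \<longrightarrow>
         incseq (\<lambda>n. \<rho> (F n)) \<and> (\<lambda>n. \<rho> (F n)) \<longlonglongrightarrow> \<rho> f) \<and>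
      (\<forall>E \<in> sets circle_measure. \<rho> (indicator E) < \<infinity>) \<and>
      (\<forall>E \<in> sets circle_measure. \<exists>C::real. C > 0 \<and>
         (\<forall>f \<in> borel_measurable circle_measure.
            (\<integral>\<^sup>+t\<in>E. f t \<partial>circle_measure) \<le> ennreal C * \<rho> f)))"

definition associate_norm ::
  "((complex \<Rightarrow> ennreal) \<Rightarrow> ennreal) \<Rightarrow> (complex \<Rightarrow> ennreal) \<Rightarrow> ennreal" where
  "associate_norm \<rho> g =
     (SUP f \<in> {f \<in> borel_measurable circle_measure. \<rho> f \<le> 1}. \<integral>\<^sup>+t. f t * g t \<partial>circle_measure)"

text \<open>The norm of the space is kept extended-valued, so that no junk value is attached to
  functions outside the space. The space itself is the set of all representatives of its
  elements; it and the subsets defined below are closed under equality almost everywhere,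
  so equality of these sets is equality of the corresponding sets of equivalence classes.\<close>

definition bfs_norm :: "((complex \<Rightarrow> ennreal) \<Rightarrow> ennreal) \<Rightarrow> (complex \<Rightarrow> complex) \<Rightarrow> ennreal" where
  "bfs_norm \<rho> f = \<rho> (\<lambda>t. ennreal (norm (f t)))"

definition bfs :: "((complex \<Rightarrow> ennreal) \<Rightarrow> ennreal) \<Rightarrow> (complex \<Rightarrow> complex) set" where
  "bfs \<rho> = {f \<in> borel_measurable circle_measure. bfs_norm \<rho> f < \<infinity>}"

definition abs_cont_part ::
  "((complex \<Rightarrow> ennreal) \<Rightarrow> ennreal) \<Rightarrow> (complex \<Rightarrow> complex) set" where
  "abs_cont_part \<rho> = {f \<in> bfs \<rho>.
     \<forall>\<gamma>::nat \<Rightarrow> complex set. (\<forall>n. \<gamma> n \<in> sets circle_measure) \<longrightarrow>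
       (AE t in circle_measure. (\<lambda>n. indicator (\<gamma> n) t :: real) \<longlonglongrightarrow> 0) \<longrightarrow>
       (\<lambda>n. bfs_norm \<rho> (\<lambda>t. f t * indicator (\<gamma> n) t)) \<longlonglongrightarrow> 0}"

definition simple_closure ::
  "((complex \<Rightarrow> ennreal) \<Rightarrow> ennreal) \<Rightarrow> (complex \<Rightarrow> complex) set" where
  "simple_closure \<rho> = {f \<in> bfs \<rho>.
     \<forall>\<epsilon>::real. \<epsilon> > 0 \<longrightarrow>
       (\<exists>s. simple_function circle_measure s \<and> bfs_norm \<rho> (\<lambda>t. f t - s t) < ennreal \<epsilon>)}"

text \<open>The principal value deletes the symmetric arc of all \<open>\<tau>\<close> at distance less than \<open>\<epsilon>\<close> from \<open>t\<close>.
  For integrable \<open>f\<close> the limit exists for almost every \<open>t\<close>; elsewhere the value is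
  unspecified, which affects only a null set. For the same reason the projection is linear
  up to equality almost everywhere.\<close>

definition cauchy_singular_integral :: "(complex \<Rightarrow> complex) \<Rightarrow> complex \<Rightarrow> complex" where
  "cauchy_singular_integral f t =
     1 / (pi * \<i>) *
     Lim (at_right 0) (\<lambda>\<epsilon>::real.
       contour_integral (circlepath 0 1) (\<lambda>\<tau>. if dist \<tau> t < \<epsilon> then 0 else f \<tau> / (\<tau> - t)))"

definition riesz_projection :: "(complex \<Rightarrow> complex) \<Rightarrow> complex \<Rightarrow> complex" where
  "riesz_projection f t = (f t + cauchy_singular_integral f t) / 2"

definition bounded_on_bfs ::
  "((complex \<Rightarrow> ennreal) \<Rightarrow> ennreal) \<Rightarrow> ((complex \<Rightarrow> complex) \<Rightarrow> complex \<Rightarrow> complex) \<Rightarrow> bool" where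
  "bounded_on_bfs \<rho> T \<longleftrightarrow>
     (\<forall>f \<in> bfs \<rho>. T f \<in> bfs \<rho>) \<and>
     (\<exists>C::real. \<forall>f \<in> bfs \<rho>. bfs_norm \<rho> (T f) \<le> ennreal C * bfs_norm \<rho> f)"

end

theory Submission imports Defs begin

text \<open>Let \<open>E\<close> be covered by finitely many arcs of total length at most \<open>\<epsilon>\<close>. Summing the functions
  \<open>\<delta> / (1 + \<delta> - z cnj t)\<close> over the arcs of centre \<open>t\<close> and radius \<open>\<delta>\<close> gives a function \<open>h\<close>, holomorphic
  near the closed disc, with \<open>Re h \<ge> 0\<close>, \<open>Re h \<ge> 1/4\<close> on \<open>E\<close> and \<open>0 \<le> h 0 \<le> \<epsilon>\<close>. For
  \<open>F = Ln (1 + h/\<epsilon>)\<close> the function \<open>v = Im F\<close> is bounded by \<open>\<pi>/2\<close>, whereas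
  \<open>P v = (F - F 0)/(2\<i>)\<close> is at least a constant times \<open>ln (1/\<epsilon>)\<close> on \<open>E\<close>. Boundedness of \<open>P\<close> on \<open>X\<close>
  forces the norm of the indicator of \<open>E\<close> to be \<open>O(1 / ln (1/\<epsilon>))\<close>, and this extends to all sets
  of small measure. For \<open>X'\<close> one bounds \<open>\<integral>\<^sub>E f\<close> by writing \<open>f\<close> on \<open>E\<close> as \<open>\<phi> P v\<close> with a small \<open>\<phi>\<close>
  and moving \<open>P\<close> from \<open>v\<close> to \<open>\<phi>\<close>. Once the norms of indicators tend to zero with the measure,
  \<open>X\<^sub>a = X\<^sub>b\<close> is elementary.\<close>

section \<open>Trigonometric polynomials and the principal value\<close>

text \<open>For a general function \<open>P\<close> admits no explicit formula, so it is evaluated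
  on trigonometric polynomials only, where the principal value can be computed in closed form; this
  is why a Taylor polynomial has to stand in for \<open>F\<close>. The logarithm is chosen because
  it maps the right half plane into the strip where the imaginary part is below
  \<open>pi / 2\<close> in modulus: the imaginary part stays bounded however large the real part
  grows. Dividing \<open>h\<close> by \<epsilon> puts \<open>1 + h 0 / \<epsilon>\<close> into the
  interval from 1 to 2, so that subtracting \<open>F 0\<close> costs at most \<open>ln 2\<close>,
  while on \<open>E\<close> the modulus of \<open>1 + h / \<epsilon>\<close> is at least
  \<open>1 + 1 / (4 * \<epsilon>)\<close>. For \<open>X'\<close> the obstacle is that
  \<open>P\<close> is controlled on \<open>X\<close> only and that \<phi> is no trigonometric
  polynomial. The order of the two halves resolves this: once the norms of indicators in
  \<open>X\<close> are known to be small, every bounded function is a limit of trigonometric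
  polynomials in \<open>X\<close>, so \<phi> may be replaced by one, and for polynomials the
  transpose of \<open>P\<close> is explicit.\<close>

lemma pv_kernel_denominator:
  fixes s :: real and k :: int
  assumes "0 < \<eta>" "\<eta> < pi" "\<theta> \<in> {s + \<eta>..s + 2 * pi - \<eta>}"
  shows "cis \<theta> \<noteq> cis s" "sin ((\<theta> - s) / 2) > 0"
proof -
  show *: "sin ((\<theta> - s) / 2) > 0"
    using assms by (intro sin_gt_zero) (auto simp: field_simps)
  show "cis \<theta> \<noteq> cis s"
  proof
    assume "cis \<theta> = cis s"
    then have "cis (\<theta> - s) = 1" by (simp flip: cis_divide)
    then have "cos (\<theta> - s) = 1" by (simp add: complex_eq_iff)
    moreover have "cos (\<theta> - s) = 1 - 2 * (sin ((\<theta> - s) / 2))\<^sup>2"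
      using cos_double_sin[of "(\<theta> - s) / 2"] by (simp only: mult_2 field_sum_of_halves)
    ultimately show False using * by simp
  qed
qed

lemma has_integral_cis_multiple:
  fixes k :: int
  assumes "a \<le> b"
  shows "((\<lambda>\<theta>. \<i> * cis (real_of_int k * \<theta>)) has_integral
     (if k = 0 then \<i> * (b - a) else (cis (real_of_int k * b) - cis (real_of_int k * a)) / k)) {a..b}"
proof (cases "k = 0")
  case True
  have "((\<lambda>\<theta>::real. \<i>) has_integral (b - a) *\<^sub>R \<i>) {a..b}"
    using has_integral_const_real[of \<i> a b] assms by simp
  then show ?thesis using True by (simp add: scaleR_conv_of_real mult.commute)
next
  case False
  have "((\<lambda>\<theta>. \<i> * cis (real_of_int k * \<theta>)) has_integral
      (cis (real_of_int k * b) / k - cis (real_of_int k * a) / k)) {a..b}"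
    using assms False
    by (intro fundamental_theorem_of_calculus)
       (auto intro!: derivative_eq_intros simp: has_vector_derivative_def scaleR_conv_of_real fun_eq_iff)
  then show ?thesis using False by (simp add: diff_divide_distrib)
qed

text \<open>With \<open>u = (\<theta> - s) / 2\<close> the integrand is
  \<open>\<i> / 2 + cot u / 2\<close>, whose antiderivative contains \<open>ln (sin u)\<close>. The
  logarithm takes the same value at both ends because the cut is symmetric about \<open>s\<close>;
  this cancellation is the effect of the principal value.\<close>

lemma has_integral_pv_kernel_0:
  fixes s :: real
  assumes "0 < \<eta>" "\<eta> < pi"
  shows "((\<lambda>\<theta>. \<i> * cis \<theta> / (cis \<theta> - cis s)) has_integral (\<i> * (pi - \<eta>))) {s + \<eta>..s + 2 * pi - \<eta>}"
proof -
  let ?G = "\<lambda>\<theta>. \<i> * of_real \<theta> / 2 + of_real (ln (sin ((\<theta> - s) / 2)))"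
  have eq: "\<i> * cis \<theta> / (cis \<theta> - cis s) =
      \<i> / 2 + of_real (cos ((\<theta> - s) / 2) / (2 * sin ((\<theta> - s) / 2)))"
    if "\<theta> \<in> {s + \<eta>..s + 2 * pi - \<eta>}" for \<theta>
  proof -
    define u where "u = (\<theta> - s) / 2"
    have t: "\<theta> = s + 2 * u" unfolding u_def by argo
    have su: "sin u > 0" using pv_kernel_denominator[OF assms that] by (simp add: u_def)
    have ne: "cis (2 * u) - 1 \<noteq> 0"
      using pv_kernel_denominator(1)[OF assms that] by (auto simp: t simp flip: cis_mult)
    have "\<i> * cis \<theta> / (cis \<theta> - cis s) = \<i> * cis (2 * u) / (cis (2 * u) - 1)"
    proof -
      have "\<i> * cis \<theta> = cis s * (\<i> * cis (2 * u))" "cis \<theta> - cis s = cis s * (cis (2 * u) - 1)"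
        by (simp_all add: t algebra_simps flip: cis_mult)
      then show ?thesis by (simp only: mult_divide_mult_cancel_left[OF cis_neq_zero])
    qed
    also have "\<dots> = \<i> / 2 + of_real (cos u / (2 * sin u))"
    proof -
      have c: "cis (2 * u) = (cis u)^2" by (simp add: Complex.DeMoivre)
      have cu: "cis u = of_real (cos u) + \<i> * of_real (sin u)" by (simp add: complex_eq_iff)
      have "of_real (cos u)^2 + of_real (sin u)^2 = (1::complex)"
        by (metis of_real_1 of_real_add of_real_power sin_cos_squared_add2)
      then have pyth: "of_real (cos u)^2 = 1 - (of_real (sin u)^2 :: complex)" by (simp add: algebra_simps)
      have "\<i> * cis (2 * u) * (2 * of_real (sin u)) =
          (\<i> * of_real (sin u) + of_real (cos u)) * (cis (2 * u) - 1)"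
        unfolding c cu using pyth
        by (simp add: power2_eq_square algebra_simps) algebra
      then show ?thesis using ne su by (simp add: field_simps)
    qed
    finally show ?thesis by (simp add: u_def)
  qed
  have "((\<lambda>\<theta>. \<i> / 2 + of_real (cos ((\<theta> - s) / 2) / (2 * sin ((\<theta> - s) / 2)))) has_integral
      (?G (s + 2 * pi - \<eta>) - ?G (s + \<eta>))) {s + \<eta>..s + 2 * pi - \<eta>}"
  proof (rule fundamental_theorem_of_calculus)
    show "s + \<eta> \<le> s + 2 * pi - \<eta>" using assms by simp
    fix \<theta> assume th: "\<theta> \<in> {s + \<eta>..s + 2 * pi - \<eta>}"
    note su = pv_kernel_denominator(2)[OF assms th]
    have "((\<lambda>\<theta>. ln (sin ((\<theta> - s) / 2))) has_real_derivative cos ((\<theta> - s) / 2) / (2 * sin ((\<theta> - s) / 2)))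
        (at \<theta> within {s + \<eta>..s + 2 * pi - \<eta>})"
      using su by (auto intro!: derivative_eq_intros simp: field_simps)
    then have 1: "((\<lambda>\<theta>. of_real (ln (sin ((\<theta> - s) / 2))) :: complex) has_vector_derivative
        of_real (cos ((\<theta> - s) / 2) / (2 * sin ((\<theta> - s) / 2)))) (at \<theta> within {s + \<eta>..s + 2 * pi - \<eta>})"
      by (intro has_vector_derivative_of_real) (simp add: has_real_derivative_iff_has_vector_derivative)
    have 2: "((\<lambda>\<theta>. \<i> * of_real \<theta> / 2 :: complex) has_vector_derivative \<i> / 2)
       (at \<theta> within {s + \<eta>..s + 2 * pi - \<eta>})"
      by (auto intro!: derivative_eq_intros)
    show "(?G has_vector_derivative \<i> / 2 + of_real (cos ((\<theta> - s) / 2) / (2 * sin ((\<theta> - s) / 2))))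
        (at \<theta> within {s + \<eta>..s + 2 * pi - \<eta>})"
      by (intro has_vector_derivative_add 1 2)
  qed
  moreover have "?G (s + 2 * pi - \<eta>) - ?G (s + \<eta>) = \<i> * (pi - \<eta>)"
  proof -
    have "sin ((s + 2 * pi - \<eta> - s) / 2) = sin (pi - \<eta> / 2)" by (simp add: field_simps)
    also have "\<dots> = sin ((s + \<eta> - s) / 2)" by simp
    finally show ?thesis by (simp add: field_simps)
  qed
  ultimately have "((\<lambda>\<theta>. \<i> / 2 + of_real (cos ((\<theta> - s) / 2) / (2 * sin ((\<theta> - s) / 2)))) has_integral
      \<i> * (pi - \<eta>)) {s + \<eta>..s + 2 * pi - \<eta>}"
    by (simp only:)
  then show ?thesis
    by (rule has_integral_eq[rotated]) (simp add: eq)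
qed

text \<open>The exponent is \<open>k + 1\<close> because the line element contributes the factor
  \<open>\<i> * cis \<theta>\<close>. Raising \<open>k\<close> by one multiplies the integral by
  \<open>cis s\<close> and adds the integral of a pure exponential, which tends to 0 over a full
  period unless the exponential is constant. It is constant exactly between \<open>k = -1\<close>
  and \<open>k = 0\<close>; there the term tends to \<open>2 * pi * \<i>\<close> and switches the
  sign of \<open>pi * \<i>\<close>. This jump separates the two halves of the spectrum.\<close>

lemma pv_kernel_limit:
  fixes s :: real and k :: int
  shows "\<exists>G. (\<forall>\<eta>. 0 < \<eta> \<longrightarrow> \<eta> < pi \<longrightarrow>
      ((\<lambda>\<theta>. \<i> * cis (real_of_int (k + 1) * \<theta>) / (cis \<theta> - cis s)) has_integral G \<eta>) {s + \<eta>..s + 2 * pi - \<eta>}) \<and>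
    (G \<longlongrightarrow> (if k \<ge> 0 then pi * \<i> else - (pi * \<i>)) * cis s powi k) (at_right 0)"
proof (induction k rule: int_induct[where k = 0])
  case base
  have "((\<lambda>\<eta>. \<i> * complex_of_real (pi - \<eta>)) \<longlongrightarrow> \<i> * complex_of_real (pi - 0)) (at_right 0)"
    by (intro tendsto_intros)
  then show ?case
    using has_integral_pv_kernel_0[of _ s] by (intro exI[of _ "\<lambda>\<eta>. \<i> * (pi - \<eta>)"]) (auto simp: mult.commute)
next
  case (step1 k)
  then obtain G where G: "\<And>\<eta>. 0 < \<eta> \<Longrightarrow> \<eta> < pi \<Longrightarrow>
      ((\<lambda>\<theta>. \<i> * cis (real_of_int (k + 1) * \<theta>) / (cis \<theta> - cis s)) has_integral G \<eta>) {s + \<eta>..s + 2 * pi - \<eta>}"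
    "(G \<longlongrightarrow> pi * \<i> * cis s powi k) (at_right 0)" by auto
  have k1: "complex_of_int (k + 1) \<noteq> 0"
    using step1(1) by (subst of_int_eq_0_iff) simp
  define H where "H = (\<lambda>\<eta>. (cis (real_of_int (k + 1) * (s + 2 * pi - \<eta>)) - cis (real_of_int (k + 1) * (s + \<eta>))) / (k + 1))"
  have "((\<lambda>\<theta>. \<i> * cis (real_of_int (k + 1 + 1) * \<theta>) / (cis \<theta> - cis s)) has_integral (cis s * G \<eta> + H \<eta>)) {s + \<eta>..s + 2 * pi - \<eta>}"
    if \<eta>: "0 < \<eta>" "\<eta> < pi" for \<eta>
  proof -
    have "((\<lambda>\<theta>. \<i> * cis (real_of_int (k + 1) * \<theta>)) has_integral H \<eta>) {s + \<eta>..s + 2 * pi - \<eta>}"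
      using has_integral_cis_multiple[of "s + \<eta>" "s + 2 * pi - \<eta>" "k + 1"] \<eta> step1(1)
      by (simp add: H_def)
    from has_integral_add[OF has_integral_mult_right[OF G(1)[OF \<eta>], of "cis s"] this]
    show ?thesis
    proof (rule has_integral_eq[rotated])
      fix \<theta> assume th: "\<theta> \<in> {s + \<eta>..s + 2 * pi - \<eta>}"
      have "cis (real_of_int (k + 1 + 1) * \<theta>) = cis (real_of_int (k + 1) * \<theta>) * cis \<theta>"
        by (simp add: cis_mult algebra_simps)
      then show "cis s * (\<i> * cis (real_of_int (k + 1) * \<theta>) / (cis \<theta> - cis s)) + \<i> * cis (real_of_int (k + 1) * \<theta>) =
         \<i> * cis (real_of_int (k + 1 + 1) * \<theta>) / (cis \<theta> - cis s)"
        using pv_kernel_denominator(1)[OF \<eta> th] by (simp add: field_simps)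
    qed
  qed
  moreover have "((\<lambda>\<eta>. cis s * G \<eta> + H \<eta>) \<longlongrightarrow> cis s * (pi * \<i> * cis s powi k) +
      (cis (real_of_int (k + 1) * (s + 2 * pi - 0)) - cis (real_of_int (k + 1) * (s + 0))) / (k + 1)) (at_right 0)"
    unfolding H_def using k1 by (intro tendsto_intros G(2)) auto
  moreover have "cis (real_of_int (k + 1) * (s + 2 * pi - 0)) = cis (real_of_int (k + 1) * (s + 0))"
    using cis_multiple_2pi[of "real_of_int (k + 1)"]
    by (simp add: distrib_left mult.commute mult.left_commute flip: cis_mult)
  ultimately show ?case
    using step1(1)
    by (intro exI[of _ "\<lambda>\<eta>. cis s * G \<eta> + H \<eta>"]) (auto simp: power_int_add mult_ac)
next
  case (step2 k)
  then obtain G where G: "\<And>\<eta>. 0 < \<eta> \<Longrightarrow> \<eta> < pi \<Longrightarrow>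
      ((\<lambda>\<theta>. \<i> * cis (real_of_int (k + 1) * \<theta>) / (cis \<theta> - cis s)) has_integral G \<eta>) {s + \<eta>..s + 2 * pi - \<eta>}"
    "(G \<longlongrightarrow> (if k \<ge> 0 then pi * \<i> else - (pi * \<i>)) * cis s powi k) (at_right 0)" by auto
  define H where "H = (\<lambda>\<eta>. if k = 0 then \<i> * (2 * pi - 2 * \<eta>) else
     (cis (real_of_int k * (s + 2 * pi - \<eta>)) - cis (real_of_int k * (s + \<eta>))) / k)"
  have f: "((\<lambda>\<theta>. \<i> * cis (real_of_int (k - 1 + 1) * \<theta>) / (cis \<theta> - cis s)) has_integral (inverse (cis s) * (G \<eta> - H \<eta>))) {s + \<eta>..s + 2 * pi - \<eta>}"
    if \<eta>: "0 < \<eta>" "\<eta> < pi" for \<eta>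
  proof -
    have "((\<lambda>\<theta>. \<i> * cis (real_of_int k * \<theta>)) has_integral H \<eta>) {s + \<eta>..s + 2 * pi - \<eta>}"
      using has_integral_cis_multiple[of "s + \<eta>" "s + 2 * pi - \<eta>" "k"] \<eta>
      by (auto simp: H_def algebra_simps)
    from has_integral_mult_right[OF has_integral_diff[OF G(1)[OF \<eta>] this], of "inverse (cis s)"]
    show ?thesis
    proof (rule has_integral_eq[rotated])
      fix \<theta> assume th: "\<theta> \<in> {s + \<eta>..s + 2 * pi - \<eta>}"
      have "cis (real_of_int (k + 1) * \<theta>) = cis (real_of_int k * \<theta>) * cis \<theta>"
        by (simp add: cis_mult algebra_simps)
      then show "inverse (cis s) * (\<i> * cis (real_of_int (k + 1) * \<theta>) / (cis \<theta> - cis s) - \<i> * cis (real_of_int k * \<theta>)) =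
         \<i> * cis (real_of_int (k - 1 + 1) * \<theta>) / (cis \<theta> - cis s)"
        using pv_kernel_denominator(1)[OF \<eta> th] by (simp add: field_simps del: cis_inverse)
    qed
  qed
  have l: "((\<lambda>\<eta>. inverse (cis s) * (G \<eta> - H \<eta>)) \<longlongrightarrow>
      inverse (cis s) * ((if k \<ge> 0 then pi * \<i> else - (pi * \<i>)) * cis s powi k - (if k = 0 then 2 * pi * \<i> else 0))) (at_right 0)"
  proof (intro tendsto_intros G(2))
    show "(H \<longlongrightarrow> (if k = 0 then 2 * pi * \<i> else 0)) (at_right 0)"
    proof (cases "k = 0")
      case True
      have "((\<lambda>\<eta>. \<i> * (2 * pi - 2 * complex_of_real \<eta>)) \<longlongrightarrow> \<i> * (2 * pi - 2 * complex_of_real 0)) (at_right 0)"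
        by (intro tendsto_intros)
      then show ?thesis using True by (simp add: H_def mult_ac)
    next
      case False
      have "((\<lambda>\<eta>. (cis (real_of_int k * (s + 2 * pi - \<eta>)) - cis (real_of_int k * (s + \<eta>))) / k) \<longlongrightarrow>
        (cis (real_of_int k * (s + 2 * pi - 0)) - cis (real_of_int k * (s + 0))) / k) (at_right 0)"
        using False by (intro tendsto_intros) auto
      moreover have "cis (real_of_int k * (s + 2 * pi - 0)) = cis (real_of_int k * (s + 0))"
        using cis_multiple_2pi[of "real_of_int k"]
        by (simp add: distrib_left mult.commute mult.left_commute flip: cis_mult)
      ultimately show ?thesis using False by (simp add: H_def)
    qed
  qed
  have e: "inverse (cis s) * ((if k \<ge> 0 then pi * \<i> else - (pi * \<i>)) * cis s powi k - (if k = 0 then 2 * pi * \<i> else 0)) =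
      - (pi * \<i>) * cis s powi (k - 1)"
    using step2(1) by (cases "k = 0") (auto simp: power_int_diff field_simps simp del: cis_inverse)
  have "((\<lambda>\<eta>. inverse (cis s) * (G \<eta> - H \<eta>)) \<longlongrightarrow> - (pi * \<i>) * cis s powi (k - 1)) (at_right 0)"
    using l by (simp only: e)
  moreover have "\<not> k - 1 \<ge> 0" using step2(1) by simp
  ultimately show ?case
    using f by (intro exI[of _ "\<lambda>\<eta>. inverse (cis s) * (G \<eta> - H \<eta>)"]) (simp only: if_False, blast)
qed

section \<open>The circle with a symmetric arc removed\<close>

lemma shiftpath_circlepath:
  "shiftpath (s / (2 * pi)) (circlepath 0 1) = part_circlepath 0 1 s (s + 2 * pi)"
proof
  fix x :: real
  have *: "circlepath 0 1 y = cis (2 * pi * y)" for y :: real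
    by (simp add: circlepath cis_conv_exp mult_ac)
  have "cis (2 * pi * (s / (2 * pi) + x - 1)) = cis (2 * pi * (s / (2 * pi) + x))"
    by (simp add: right_diff_distrib flip: cis_divide)
  moreover have "part_circlepath 0 1 s (s + 2 * pi) x = cis (2 * pi * (s / (2 * pi) + x))"
    by (simp add: part_circlepath_def linepath_def cis_conv_exp algebra_simps)
  ultimately show "shiftpath (s / (2 * pi)) (circlepath 0 1) x = part_circlepath 0 1 s (s + 2 * pi) x"
    unfolding shiftpath_def * by simp
qed

lemma norm_cis_diff: "norm (cis a - cis b) = 2 * \<bar>sin ((a - b) / 2)\<bar>"
proof -
  have "cis a - cis b = cis ((a + b) / 2) * (2 * \<i> * of_real (sin ((a - b) / 2)))"
  proof -
    define u v where "u = (a + b) / 2" and "v = (a - b) / 2"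
    have "a = u + v" "b = u - v" unfolding u_def v_def by (simp_all add: field_simps)
    then show ?thesis unfolding u_def[symmetric] v_def[symmetric]
      by (simp add: complex_eq_iff cos_add cos_diff sin_add sin_diff)
  qed
  then show ?thesis by (simp add: norm_mult)
qed

lemma arcsin_half_bounds:
  fixes \<epsilon> :: real
  assumes "0 < \<epsilon>" "\<epsilon> < 2"
  shows "0 < 2 * arcsin (\<epsilon> / 2)" "2 * arcsin (\<epsilon> / 2) < pi"
proof -
  have "arcsin 0 < arcsin (\<epsilon> / 2)" using assms by (subst arcsin_less_mono) auto
  then show "0 < 2 * arcsin (\<epsilon> / 2)" by simp
  have "arcsin (\<epsilon> / 2) < arcsin 1" using assms by (subst arcsin_less_mono) auto
  then show "2 * arcsin (\<epsilon> / 2) < pi" by simp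
qed

text \<open>A chord of length \<epsilon> subtends the angle
  \<open>2 * arcsin (\<epsilon> / 2)\<close>, so deleting by distance means deleting an interval of
  angles; \<open>\<epsilon> < 2\<close> keeps this angle below \<open>pi\<close>. Starting the
  circle at the angle \<open>s\<close> puts the deleted arc at the two ends of the parameter range
  and leaves a single interval.\<close>

lemma has_contour_integral_cut_circle:
  fixes s \<epsilon> :: real
  assumes f: "((\<lambda>\<theta>. f (cis \<theta>) * \<i> * cis \<theta>) has_integral I) {s + \<eta>..s + 2 * pi - \<eta>}"
    and s: "0 \<le> s" "s < 2 * pi" and \<epsilon>: "0 < \<epsilon>" "\<epsilon> < 2" and \<eta>: "\<eta> = 2 * arcsin (\<epsilon> / 2)"
  shows "((\<lambda>\<tau>. if dist \<tau> (cis s) < \<epsilon> then 0 else f \<tau>) has_contour_integral I) (circlepath 0 1)"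
proof -
  have sin\<eta>: "sin (\<eta> / 2) = \<epsilon> / 2" using \<epsilon> by (simp add: \<eta>)
  have \<eta>_bd: "0 < \<eta>" "\<eta> < pi" unfolding \<eta> using arcsin_half_bounds[OF \<epsilon>] by auto
  have cut: "dist (cis \<theta>) (cis s) < \<epsilon> \<longleftrightarrow> \<theta> \<notin> {s + \<eta>..s + 2 * pi - \<eta>}"
    if \<theta>: "\<theta> \<in> {s..s + 2 * pi}" for \<theta>
  proof -
    define u where "u = (\<theta> - s) / 2"
    have u: "0 \<le> u" "u \<le> pi" using \<theta> by (auto simp: u_def)
    have d: "dist (cis \<theta>) (cis s) = 2 * sin u"
      using sin_ge_zero[OF u] by (simp add: dist_norm norm_cis_diff flip: u_def)
    have "2 * sin u < \<epsilon> \<longleftrightarrow> sin u < sin (\<eta> / 2)" by (simp add: sin\<eta>) linarith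
    also have "\<dots> \<longleftrightarrow> u < \<eta> / 2 \<or> u > pi - \<eta> / 2"
    proof (cases "u \<le> pi / 2")
      case True
      then have "sin u < sin (\<eta> / 2) \<longleftrightarrow> u < \<eta> / 2" using u \<eta>_bd by (intro sin_mono_less_eq) auto
      then show ?thesis using True \<eta>_bd by auto
    next
      case False
      then have "sin (pi - u) < sin (\<eta> / 2) \<longleftrightarrow> pi - u < \<eta> / 2" using u \<eta>_bd by (intro sin_mono_less_eq) auto
      then show ?thesis using False \<eta>_bd by auto
    qed
    also have "\<dots> \<longleftrightarrow> \<theta> \<notin> {s + \<eta>..s + 2 * pi - \<eta>}" by (auto simp: u_def field_simps)
    finally show ?thesis by (simp add: d)
  qed
  let ?f = "\<lambda>\<tau>. if dist \<tau> (cis s) < \<epsilon> then 0 else f \<tau>"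
  have "((\<lambda>\<theta>. if \<theta> \<in> {s + \<eta>..s + 2 * pi - \<eta>} then f (cis \<theta>) * \<i> * cis \<theta> else 0) has_integral I) {s..s + 2 * pi}"
    using f \<eta>_bd by (subst has_integral_restrict) auto
  then have "((\<lambda>\<theta>. ?f (0 + of_real 1 * cis \<theta>) * of_real 1 * \<i> * cis \<theta>) has_integral I) {s..s + 2 * pi}"
    by (rule has_integral_eq[rotated]) (use cut in auto)
  then have "(?f has_contour_integral I) (part_circlepath 0 1 s (s + 2 * pi))"
    by (subst has_contour_integral_part_circlepath_iff) auto
  then have "(?f has_contour_integral I) (shiftpath (s / (2 * pi)) (circlepath 0 1))"
    by (simp only: shiftpath_circlepath)
  then show ?thesis
    by (subst (asm) has_contour_integral_shiftpath_eq) (use s in auto)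
qed

text \<open>\<open>trig_poly p q\<close>: on the circle, \<open>p\<close> is a trigonometric polynomial and \<open>q\<close> is its analytic part,
  that is, the sum of its terms with nonnegative exponents.\<close>

inductive trig_poly :: "(complex \<Rightarrow> complex) \<Rightarrow> (complex \<Rightarrow> complex) \<Rightarrow> bool" where
  monom: "trig_poly (\<lambda>z. c * z powi k) (\<lambda>z. if k \<ge> 0 then c * z powi k else 0)"
| add: "trig_poly p q \<Longrightarrow> trig_poly p' q' \<Longrightarrow> trig_poly (\<lambda>z. p z + p' z) (\<lambda>z. q z + q' z)"

lemma cis_power_int: "cis s powi k = cis (real_of_int k * s)"
  by (cases "k \<ge> 0") (auto simp: power_int_def Complex.DeMoivre)

text \<open>The limit is \<open>pi * \<i>\<close> times \<open>S p = 2 * P p - p\<close>, with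
  \<open>q\<close> in the place of \<open>P p\<close>. The existence of the cut integrals is carried
  along, since adding them in the sum rule requires it.\<close>

lemma trig_poly_pv:
  fixes s :: real
  assumes "trig_poly p q" and s: "0 \<le> s" "s < 2 * pi"
  shows "\<exists>I. (\<forall>\<epsilon>. 0 < \<epsilon> \<longrightarrow> \<epsilon> < 2 \<longrightarrow>
      ((\<lambda>\<tau>. if dist \<tau> (cis s) < \<epsilon> then 0 else p \<tau> / (\<tau> - cis s)) has_contour_integral I \<epsilon>) (circlepath 0 1)) \<and>
    (I \<longlongrightarrow> pi * \<i> * (2 * q (cis s) - p (cis s))) (at_right 0)"
  using assms(1)
proof induction
  case (monom c k)
  obtain G where G: "\<And>\<eta>. 0 < \<eta> \<Longrightarrow> \<eta> < pi \<Longrightarrow>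
      ((\<lambda>\<theta>. \<i> * cis (real_of_int (k + 1) * \<theta>) / (cis \<theta> - cis s)) has_integral G \<eta>) {s + \<eta>..s + 2 * pi - \<eta>}"
    "(G \<longlongrightarrow> (if k \<ge> 0 then pi * \<i> else - (pi * \<i>)) * cis s powi k) (at_right 0)"
    using pv_kernel_limit[where s = s and k = k] by blast
  let ?\<eta> = "\<lambda>\<epsilon>::real. 2 * arcsin (\<epsilon> / 2)"
  note \<eta>_bd = arcsin_half_bounds
  have "((\<lambda>\<tau>. if dist \<tau> (cis s) < \<epsilon> then 0 else c * \<tau> powi k / (\<tau> - cis s)) has_contour_integral c * G (?\<eta> \<epsilon>)) (circlepath 0 1)"
    if "0 < \<epsilon>" "\<epsilon> < 2" for \<epsilon>
  proof (rule has_contour_integral_cut_circle[OF _ s that refl])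
    show "((\<lambda>\<theta>. c * cis \<theta> powi k / (cis \<theta> - cis s) * \<i> * cis \<theta>) has_integral c * G (?\<eta> \<epsilon>)) {s + ?\<eta> \<epsilon>..s + 2 * pi - ?\<eta> \<epsilon>}"
      by (rule has_integral_eq[OF _ has_integral_mult_right[OF G(1)[OF \<eta>_bd[OF that]], of c]])
         (simp add: cis_power_int distrib_right flip: cis_mult)
  qed
  moreover have "((\<lambda>\<epsilon>. c * G (?\<eta> \<epsilon>)) \<longlongrightarrow> c * ((if k \<ge> 0 then pi * \<i> else - (pi * \<i>)) * cis s powi k)) (at_right 0)"
  proof (intro tendsto_intros filterlim_compose[OF G(2)])
    have "((\<lambda>\<epsilon>::real. \<epsilon> / 2) \<longlongrightarrow> 0) (at_right 0)"
      using tendsto_divide[OF tendsto_ident_at[of "0::real" "{0<..}"] tendsto_const[of "2::real"]] by simp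
    then have "((\<lambda>\<epsilon>. arcsin (\<epsilon> / 2)) \<longlongrightarrow> arcsin 0) (at_right 0)"
      by (rule isCont_tendsto_compose[OF isCont_arcsin, rotated -1]) auto
    then have "(?\<eta> \<longlongrightarrow> 2 * arcsin 0) (at_right 0)"
      by (rule tendsto_mult_left)
    moreover have "\<forall>\<^sub>F \<epsilon> in at_right 0. ?\<eta> \<epsilon> \<in> {0<..}"
      unfolding eventually_at_right_field
    proof (intro exI conjI allI impI)
      fix y :: real assume "0 < y" "y < 2"
      then show "?\<eta> y \<in> {0<..}" using \<eta>_bd(1)[of y] by simp
    qed simp
    ultimately show "filterlim ?\<eta> (at_right 0) (at_right 0)"
      unfolding filterlim_at by (auto elim: eventually_mono)
  qed
  ultimately show ?case
    by (intro exI[of _ "\<lambda>\<epsilon>. c * G (?\<eta> \<epsilon>)"]) (auto simp: mult_ac)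
next
  case (add p q p' q')
  then obtain I I' where I: "\<And>\<epsilon>. 0 < \<epsilon> \<Longrightarrow> \<epsilon> < 2 \<Longrightarrow>
      ((\<lambda>\<tau>. if dist \<tau> (cis s) < \<epsilon> then 0 else p \<tau> / (\<tau> - cis s)) has_contour_integral I \<epsilon>) (circlepath 0 1)"
    "(I \<longlongrightarrow> pi * \<i> * (2 * q (cis s) - p (cis s))) (at_right 0)"
    and I': "\<And>\<epsilon>. 0 < \<epsilon> \<Longrightarrow> \<epsilon> < 2 \<Longrightarrow>
      ((\<lambda>\<tau>. if dist \<tau> (cis s) < \<epsilon> then 0 else p' \<tau> / (\<tau> - cis s)) has_contour_integral I' \<epsilon>) (circlepath 0 1)"
    "(I' \<longlongrightarrow> pi * \<i> * (2 * q' (cis s) - p' (cis s))) (at_right 0)"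
    by blast
  have "((\<lambda>\<tau>. if dist \<tau> (cis s) < \<epsilon> then 0 else (p \<tau> + p' \<tau>) / (\<tau> - cis s)) has_contour_integral I \<epsilon> + I' \<epsilon>) (circlepath 0 1)"
    if "0 < \<epsilon>" "\<epsilon> < 2" for \<epsilon>
  proof -
    have "(\<lambda>\<tau>. if dist \<tau> (cis s) < \<epsilon> then 0 else (p \<tau> + p' \<tau>) / (\<tau> - cis s)) =
      (\<lambda>\<tau>. (if dist \<tau> (cis s) < \<epsilon> then 0 else p \<tau> / (\<tau> - cis s)) + (if dist \<tau> (cis s) < \<epsilon> then 0 else p' \<tau> / (\<tau> - cis s)))"
      by (auto simp: add_divide_distrib)
    then show ?thesis using has_contour_integral_add[OF I(1)[OF that] I'(1)[OF that]] by simp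
  qed
  moreover have "((\<lambda>\<epsilon>. I \<epsilon> + I' \<epsilon>) \<longlongrightarrow> pi * \<i> * (2 * (q (cis s) + q' (cis s)) - (p (cis s) + p' (cis s)))) (at_right 0)"
    using tendsto_add[OF I(2) I'(2)] by (simp add: algebra_simps)
  ultimately show ?case by (intro exI[of _ "\<lambda>\<epsilon>. I \<epsilon> + I' \<epsilon>"] conjI allI impI)
qed

text \<open>The identity holds at every point of the circle, not only almost everywhere. It is all
  that the later sections use about the principal value.\<close>

lemma riesz_projection_trig_poly:
  assumes "trig_poly p q" "norm t = 1"
  shows "riesz_projection p t = q t"
proof -
  define s where "s = Arg2pi t"
  have s: "0 \<le> s" "s < 2 * pi" using Arg2pi[of t] by (auto simp: s_def)
  have t: "t = cis s"
    using assms(2) by (simp add: s_def cis_conv_exp complex_norm_eq_1_exp)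
  obtain I where I: "\<And>\<epsilon>. 0 < \<epsilon> \<Longrightarrow> \<epsilon> < 2 \<Longrightarrow>
      ((\<lambda>\<tau>. if dist \<tau> t < \<epsilon> then 0 else p \<tau> / (\<tau> - t)) has_contour_integral I \<epsilon>) (circlepath 0 1)"
    "(I \<longlongrightarrow> pi * \<i> * (2 * q t - p t)) (at_right 0)"
    using trig_poly_pv[OF assms(1) s] unfolding t by blast
  have "((\<lambda>\<epsilon>. contour_integral (circlepath 0 1) (\<lambda>\<tau>. if dist \<tau> t < \<epsilon> then 0 else p \<tau> / (\<tau> - t)))
      \<longlongrightarrow> pi * \<i> * (2 * q t - p t)) (at_right 0)"
  proof (rule Lim_transform_eventually[OF I(2)])
    show "\<forall>\<^sub>F \<epsilon> in at_right 0. I \<epsilon> = contour_integral (circlepath 0 1) (\<lambda>\<tau>. if dist \<tau> t < \<epsilon> then 0 else p \<tau> / (\<tau> - t))"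
      unfolding eventually_at_right_field
      by (intro exI[of _ 2]) (auto simp: contour_integral_unique[OF I(1)])
  qed
  then have "cauchy_singular_integral p t = 1 / (pi * \<i>) * (pi * \<i> * (2 * q t - p t))"
    unfolding cauchy_singular_integral_def by (subst tendsto_Lim) auto
  then show ?thesis by (simp add: riesz_projection_def)
qed

section \<open>Bounded trigonometric polynomials with large projection\<close>

lemma trig_poly_zero: "trig_poly (\<lambda>_. 0) (\<lambda>_. 0)"
  using trig_poly.monom[of 0 0] by simp

lemma trig_poly_sum:
  "finite A \<Longrightarrow> (\<And>i. i \<in> A \<Longrightarrow> trig_poly (p i) (q i)) \<Longrightarrow>
    trig_poly (\<lambda>z. \<Sum>i\<in>A. p i z) (\<lambda>z. \<Sum>i\<in>A. q i z)"
  by (induction A rule: finite_induct) (auto intro: trig_poly_zero trig_poly.add)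

text \<open>Convergence at the radius \<open>(1 + r) / 2 > 1\<close> makes the coefficients
  absolutely summable, so one tail bound serves the whole closed disc. The condition
  \<open>N > 0\<close> keeps the constant term \<open>a 0 = F 0\<close> in the polynomial.\<close>

lemma holomorphic_Taylor_approx:
  assumes "F holomorphic_on ball 0 r" "r > 1" "e > 0"
  obtains N a where "a 0 = F 0" "N > 0"
    "\<And>z. norm z \<le> 1 \<Longrightarrow> norm (F z - (\<Sum>n<N. a n * z ^ n)) < e"
proof -
  define a where "a = (\<lambda>n. (deriv ^^ n) F 0 / fact n)"
  have sums: "(\<lambda>n. a n * z ^ n) sums F z" if "norm z < r" for z
    using holomorphic_power_series[OF assms(1), of z] that by (simp add: a_def)
  have "summable (\<lambda>n. a n * (complex_of_real ((1 + r) / 2)) ^ n)"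
    using assms(2) by (intro sums_summable[OF sums]) (simp only: norm_of_real, simp)
  then have "summable (\<lambda>n. norm (a n * 1 ^ n))"
    by (rule powser_insidea) (use assms(2) in \<open>simp only: norm_of_real, simp\<close>)
  then have sn: "summable (\<lambda>n. norm (a n))" by simp
  then obtain N where N: "\<And>n. n \<ge> N \<Longrightarrow> norm (\<Sum>i. norm (a (i + n))) < e"
    using suminf_exist_split[OF assms(3) sn] by blast
  show ?thesis
  proof (rule that[of a "Suc N"])
    show "a 0 = F 0" by (simp add: a_def)
    fix z :: complex assume z: "norm z \<le> 1"
    then have s: "(\<lambda>n. a n * z ^ n) sums F z" using sums assms(2) by simp
    have le: "norm (a n * z ^ n) \<le> norm (a n)" for n
      using mult_left_mono[OF power_le_one[OF norm_ge_zero z, of n], of "norm (a n)"]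
      by (simp add: norm_mult norm_power)
    have sn': "summable (\<lambda>i. norm (a (i + Suc N)))" using summable_ignore_initial_segment[OF sn] .
    have "F z - (\<Sum>n<Suc N. a n * z ^ n) = (\<Sum>i. a (i + Suc N) * z ^ (i + Suc N))"
      unfolding sums_unique[OF s] suminf_split_initial_segment[OF sums_summable[OF s], of "Suc N"]
      by (rule add_diff_cancel_right')
    also have "norm \<dots> \<le> (\<Sum>i. norm (a (i + Suc N)))"
      by (rule norm_suminf_le[OF le sn']) 
    also have "\<dots> < e" using N[of "Suc N"] suminf_nonneg[OF sn'] by simp
    finally show "norm (F z - (\<Sum>n<Suc N. a n * z ^ n)) < e" .
  qed simp
qed

lemma norm_1_inverse_eq_cnj: "norm z = 1 \<Longrightarrow> inverse z = cnj z"
  using complex_norm_square[of z] by (intro inverse_unique) simp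

text \<open>The function \<open>F\<close> is holomorphic beyond the closed disc, so on the circle a Taylor polynomial may
  replace it; this costs the bound \<open>3 > \<pi>/2 + 1\<close> and the summand \<open>- 1\<close>.\<close>

lemma trig_poly_bounded_with_large_projection:
  fixes t :: "'i \<Rightarrow> complex" and L \<epsilon> :: real
  assumes J: "finite J" "\<And>k. k \<in> J \<Longrightarrow> norm (t k) = 1"
    and L: "L > 0" and \<epsilon>: "\<epsilon> > 0" and card: "card J * L \<le> \<epsilon>"
  obtains p q where "trig_poly p q" "\<And>z. norm z = 1 \<Longrightarrow> norm (p z) \<le> 3"
    "\<And>z k. norm z = 1 \<Longrightarrow> k \<in> J \<Longrightarrow> dist z (t k) \<le> L \<Longrightarrow>
       (ln (1 + 1 / (4 * \<epsilon>)) - ln 2 - 1) / 2 \<le> norm (q z)"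
proof -
  define w where "w = (\<lambda>k z. 1 + L - z * cnj (t k))"
  define h where "h = (\<lambda>z. \<Sum>k\<in>J. L / w k z)"
  define F where "F = (\<lambda>z. Ln (1 + h z / \<epsilon>))"
  have Re_w: "Re (w k z) \<ge> 1 + L - norm z" if "k \<in> J" for k z
    using complex_Re_le_cmod[of "z * cnj (t k)"] J(2)[OF that] by (simp add: w_def norm_mult)
  have Re_Lw: "Re (L / w k z) = L * Re (w k z) / (norm (w k z))\<^sup>2" for k z
    by (simp add: Re_divide cmod_power2)
  have Re_pos: "Re (L / w k z) \<ge> 0" if "k \<in> J" "norm z < 1 + L" for k z
    unfolding Re_Lw using Re_w[OF that(1), of z] that(2) L by (intro divide_nonneg_nonneg mult_nonneg_nonneg) auto
  have Re_h: "Re (h z) \<ge> 0" if "norm z < 1 + L" for z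
    unfolding h_def Re_sum using that by (intro sum_nonneg Re_pos) auto
  have Re_1h: "Re (1 + h z / \<epsilon>) \<ge> 1" if "norm z < 1 + L" for z
    using Re_h[OF that] \<epsilon> by simp
  \<comment> \<open>The pole of the summand for \<open>k\<close> has modulus \<open>1 + L\<close>.
    Inside that disc all summands have nonnegative real part, so the argument of \<open>Ln\<close>
    stays away from the branch cut.\<close>
  have holF: "F holomorphic_on ball 0 (1 + L)"
  proof -
    have "1 + complex_of_real L - z * cnj (t k) \<noteq> 0" if "z \<in> ball 0 (1 + L)" "k \<in> J" for z k
      using Re_w[OF that(2), of z] that(1) by (auto simp: w_def complex_eq_iff)
    then have "h holomorphic_on ball 0 (1 + L)"
      unfolding h_def w_def by (intro holomorphic_intros) auto
    then have "(\<lambda>z. 1 + h z / \<epsilon>) holomorphic_on ball 0 (1 + L)"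
      using \<epsilon> by (intro holomorphic_intros) auto
    moreover have "1 + h z / \<epsilon> \<notin> \<real>\<^sub>\<le>\<^sub>0" if "z \<in> ball 0 (1 + L)" for z
      using Re_1h[of z] that by (auto simp: complex_nonpos_Reals_iff)
    ultimately show ?thesis
      unfolding F_def by (rule holomorphic_on_Ln'[rotated])
  qed
  obtain N a where a: "a 0 = F 0" "N > 0"
    and approx: "\<And>z. norm z \<le> 1 \<Longrightarrow> norm (F z - (\<Sum>n<N. a n * z ^ n)) < 1"
    by (rule holomorphic_Taylor_approx[OF holF, of 1]) (use L in auto)
  define Q where "Q = (\<lambda>z. \<Sum>n<N. a n * z ^ n)"
  \<comment> \<open>These are the coefficients of \<open>(Q - cnj Q) / (2 * \<i>) = Im Q\<close>,
    with \<open>cnj z = inverse z\<close> on the circle. Both sums contain the exponent 0, so the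
    analytic part \<open>q\<close> retains one constant term of the second sum, namely the one with
    \<open>cnj (F 0)\<close>.\<close>
  define p where "p = (\<lambda>z::complex. (\<Sum>n<N. a n / (2 * \<i>) * z powi int n) + (\<Sum>n<N. - cnj (a n) / (2 * \<i>) * z powi (- int n)))"
  define q where "q = (\<lambda>z. (\<Sum>n<N. if int n \<ge> 0 then a n / (2 * \<i>) * z powi int n else 0) +
     (\<Sum>n<N. if - int n \<ge> 0 then - cnj (a n) / (2 * \<i>) * z powi (- int n) else 0))"
  have pq: "trig_poly p q"
    unfolding p_def q_def by (intro trig_poly.add trig_poly_sum trig_poly.monom) auto
  have p_eq: "p z = of_real (Im (Q z))" if "norm z = 1" for z
  proof -
    have "z powi (- int n) = cnj z ^ n" for n
      using norm_1_inverse_eq_cnj[OF that] by (simp add: power_int_minus flip: power_inverse)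
    then have "(\<Sum>n<N. - cnj (a n) / (2 * \<i>) * z powi (- int n)) = - cnj (Q z) / (2 * \<i>)"
      unfolding Q_def cnj_sum sum_negf[symmetric] sum_divide_distrib by (intro sum.cong) auto
    moreover have "(\<Sum>n<N. a n / (2 * \<i>) * z powi int n) = Q z / (2 * \<i>)"
      unfolding Q_def sum_divide_distrib by (intro sum.cong) auto
    ultimately have "p z = (Q z - cnj (Q z)) / (2 * \<i>)"
      by (simp only: p_def add_divide_distrib[symmetric] diff_conv_add_uminus)
    also have "\<dots> = of_real (Im (Q z))" by (simp add: complex_eq_iff)
    finally show ?thesis .
  qed
  have q_eq: "q z = (Q z - cnj (F 0)) / (2 * \<i>)" for z
  proof -
    have "(\<Sum>n<N. if - int n \<ge> 0 then - cnj (a n) / (2 * \<i>) * z powi (- int n) else 0) =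
       (\<Sum>n\<in>{0}. - cnj (a n) / (2 * \<i>) * z powi (- int n))"
      using a(2) by (intro sum.mono_neutral_cong_right) auto
    also have "\<dots> = - cnj (F 0) / (2 * \<i>)" by (simp add: a(1))
    finally have "(\<Sum>n<N. if - int n \<ge> 0 then - cnj (a n) / (2 * \<i>) * z powi (- int n) else 0) =
        - cnj (F 0) / (2 * \<i>)" .
    moreover have "(\<Sum>n<N. if int n \<ge> 0 then a n / (2 * \<i>) * z powi int n else 0) = Q z / (2 * \<i>)"
      unfolding Q_def sum_divide_distrib by (intro sum.cong) auto
    ultimately show ?thesis
      by (simp only: q_def add_divide_distrib[symmetric] diff_conv_add_uminus)
  qed
  have h0: "h 0 = of_real (card J * L / (1 + L))" by (simp add: h_def w_def)
  have h0_bd: "0 \<le> card J * L / (1 + L)" "card J * L / (1 + L) \<le> \<epsilon>"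
  proof -
    have "card J * L / (1 + L) \<le> card J * L" using L by (simp add: field_simps)
    then show "card J * L / (1 + L) \<le> \<epsilon>" using card by linarith
  qed (use L in auto)
  have F0: "norm (F 0) \<le> ln 2"
  proof -
    define x where "x = card J * L / (1 + L) / \<epsilon>"
    have "0 \<le> x" unfolding x_def by (rule divide_nonneg_pos[OF h0_bd(1) \<epsilon>])
    moreover have "x \<le> 1" unfolding x_def using h0_bd(2) \<epsilon> by (subst divide_le_eq_1_pos)
    ultimately have x: "0 \<le> x" "x \<le> 1" by auto
    have "F 0 = Ln (of_real (1 + x))" by (simp add: F_def h0 x_def)
    also have "\<dots> = of_real (ln (1 + x))" using x by (subst Ln_of_real) auto
    also have "norm \<dots> \<le> ln 2" using x by simp
    finally show ?thesis .
  qed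
  show ?thesis
  proof (rule that[OF pq])
    fix z :: complex assume z: "norm z = 1"
    have "1 + h z / \<epsilon> \<noteq> 0" "0 < Re (1 + h z / \<epsilon>)" using Re_1h[of z] z L by fastforce+
    then have "\<bar>Im (F z)\<bar> < pi / 2"
      unfolding F_def using Re_Ln_pos_lt by blast
    moreover have "\<bar>Im (F z) - Im (Q z)\<bar> < 1"
      using abs_Im_le_cmod[of "F z - Q z"] approx[of z] z by (simp add: Q_def)
    ultimately have "\<bar>Im (Q z)\<bar> < 3" using pi_less_4 by linarith
    then show "norm (p z) \<le> 3" by (simp add: p_eq[OF z])
    fix k assume k: "k \<in> J" "dist z (t k) \<le> L"
    \<comment> \<open>Near \<open>t k\<close> both \<open>Re (w k z) \<ge> L\<close> and
      \<open>norm (w k z) \<le> 2 * L\<close> hold, so this one summand has real part at least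
      \<open>L * L / (2 * L)^2 = 1 / 4\<close>. The other summands can only add to it.\<close>
    have ge: "Re (w k z) \<ge> L" using Re_w[OF k(1), of z] z by simp
    have "1 - z * cnj (t k) = cnj (t k) * (t k - z)"
      using complex_norm_square[of "t k"] J(2)[OF k(1)] by (simp add: algebra_simps)
    then have "norm (1 - z * cnj (t k)) \<le> L"
      using k(2) J(2)[OF k(1)] by (simp add: norm_mult dist_norm norm_minus_commute)
    then have "norm (w k z) \<le> 2 * L"
      using norm_triangle_ineq[of "of_real L" "1 - z * cnj (t k)"] L by (simp add: w_def algebra_simps)
    then have "(norm (w k z))\<^sup>2 \<le> (2 * L)\<^sup>2" by (intro power_mono) auto
    moreover have "0 < norm (w k z)" using ge L by auto
    ultimately have "1 / 4 \<le> L * L / (norm (w k z))\<^sup>2" using L by (simp add: field_simps power2_eq_square)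
    also have "\<dots> \<le> Re (L / w k z)" unfolding Re_Lw using ge L by (intro divide_right_mono mult_left_mono) auto
    also have "\<dots> \<le> Re (h z)"
      unfolding h_def Re_sum using J(1) k(1) z L by (intro member_le_sum Re_pos) auto
    finally have "1 + 1 / (4 * \<epsilon>) \<le> Re (1 + h z / \<epsilon>)"
      using \<epsilon> by (simp add: field_simps)
    also have "\<dots> \<le> norm (1 + h z / \<epsilon>)" by (rule complex_Re_le_cmod)
    finally have le: "1 + 1 / (4 * \<epsilon>) \<le> norm (1 + h z / \<epsilon>)" .
    have pos: "0 < 1 + 1 / (4 * \<epsilon>)" using \<epsilon> by (intro add_pos_pos) auto
    have "ln (1 + 1 / (4 * \<epsilon>)) \<le> ln (norm (1 + h z / \<epsilon>))"
      using le pos less_le_trans[OF pos le] by (subst ln_le_cancel_iff)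
    also have "\<dots> = Re (F z)" using \<open>1 + h z / \<epsilon> \<noteq> 0\<close> by (simp add: F_def)
    also have "\<dots> \<le> norm (F z)" by (rule complex_Re_le_cmod)
    \<comment> \<open>The first term is the Taylor error, below 1; the middle one is
      \<open>2 * norm (q z)\<close>; the last is at most \<open>ln 2\<close>. This accounts for the
      constants in the claim.\<close>
    also have "norm (F z) \<le> norm (F z - Q z) + norm (Q z - cnj (F 0)) + norm (F 0)"
      using norm_triangle_ineq[of "F z - Q z" "Q z"] norm_triangle_ineq[of "Q z - cnj (F 0)" "cnj (F 0)"] by simp
    finally show "(ln (1 + 1 / (4 * \<epsilon>)) - ln 2 - 1) / 2 \<le> norm (q z)"
      using F0 approx[of z] z by (simp add: q_eq norm_divide norm_mult Q_def)
  qed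
qed

section \<open>Normalized Lebesgue measure on the circle\<close>

lemma borel_measurable_circle:
  "f \<in> borel_measurable borel \<Longrightarrow> f \<in> borel_measurable circle_measure"
  unfolding circle_measure_def
  by (intro measurable_completion) (auto simp: measurable_restrict_space1)

lemma borel_measurable_Arg2pi: "Arg2pi \<in> borel_measurable borel"
  by (rule borel_measurableI_le) (use closed_Arg2pi2pi_le in \<open>auto intro: borel_closed\<close>)

lemma norm_cis_diff_le: "norm (cis a - cis b) \<le> \<bar>a - b\<bar>"
  unfolding norm_cis_diff using abs_sin_le_one abs_sin_x_le_abs_x[of "(a - b) / 2"] by simp

lemma cis_Arg2pi: "norm z = 1 \<Longrightarrow> cis (Arg2pi z) = z"
  by (simp add: cis_conv_exp complex_norm_eq_1_exp)

lemma emeasure_circle_base: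
  assumes "A \<in> sets (restrict_space borel (sphere 0 1))"
  shows "cis -` A \<in> sets borel"
    and "emeasure (distr (uniform_measure lborel {0..<2 * pi}) (restrict_space borel (sphere 0 1)) cis) A =
      emeasure lborel ({0..<2 * pi} \<inter> cis -` A) / ennreal (2 * pi)"
proof -
  show *: "cis -` A \<in> sets borel"
    using measurable_sets[OF cis_measurable_circle assms] by simp
  show "emeasure (distr (uniform_measure lborel {0..<2 * pi}) (restrict_space borel (sphere 0 1)) cis) A =
      emeasure lborel ({0..<2 * pi} \<inter> cis -` A) / ennreal (2 * pi)"
    using * by (subst emeasure_distr[OF cis_measurable_circle assms]) (simp add: emeasure_uniform_measure)
qed

text \<open>All arcs of stage \<open>n\<close> have the same length and are disjoint, so the bound on
  \<open>card (J n) * L n\<close> is a bound on the measure of a surrounding open set.\<close>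

lemma circle_arc_cover:
  assumes A: "A \<in> sets circle_measure" and less: "emeasure circle_measure A < ennreal (\<epsilon> / (2 * pi))"
  obtains V :: "nat \<Rightarrow> complex set" and J :: "nat \<Rightarrow> nat set" and L :: "nat \<Rightarrow> real" where
    "\<And>n. V n \<in> sets circle_measure" "incseq V" "A \<subseteq> (\<Union>n. V n)" "\<And>n. finite (J n)" "\<And>n. L n > 0"
    "\<And>n. card (J n) * L n \<le> \<epsilon>"
    "\<And>n z. z \<in> V n \<Longrightarrow> norm z = 1 \<and> (\<exists>k\<in>J n. dist z (cis (real k * L n)) \<le> L n)"
proof -
  have \<epsilon>: "\<epsilon> > 0"
  proof (rule ccontr)
    assume "\<not> \<epsilon> > 0"
    then have "\<epsilon> / (2 * pi) \<le> 0" by (simp add: divide_nonpos_pos)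
    then show False using less by (simp add: ennreal_neg)
  qed
  \<comment> \<open>The completion is removed by passing to a hull \<open>A'\<close> of the same
    measure that is measurable before completion; its measure is then a length of angles divided by
    \<open>2 * pi\<close>.\<close>
  obtain A' where A': "A' \<in> sets (restrict_space borel (sphere 0 1))" "A \<subseteq> A'"
    "emeasure circle_measure A = emeasure lborel ({0..<2 * pi} \<inter> cis -` A') / ennreal (2 * pi)"
    using completion_upper[OF A[unfolded circle_measure_def]] emeasure_circle_base(2)
    unfolding circle_measure_def by (metis sets_distr)
  define B where "B = {0..<2 * pi} \<inter> cis -` A'"
  have B[measurable]: "B \<in> sets borel" using emeasure_circle_base(1)[OF A'(1)] by (simp add: B_def)
  have B_less: "emeasure lborel B < ennreal \<epsilon>"
  proof -
    have "emeasure lborel B / ennreal (2 * pi) < ennreal \<epsilon> / ennreal (2 * pi)"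
      using less A'(3) \<epsilon> by (simp add: B_def divide_ennreal)
    then show ?thesis
      by (metis divide_right_mono_ennreal linorder_not_less)
  qed
  then obtain b where b: "emeasure lborel B = ennreal b" "0 \<le> b" "b < \<epsilon>"
    using \<epsilon> by (cases "emeasure lborel B") (auto simp: ennreal_less_iff)
  obtain U where U: "open U" "B \<subseteq> U" "emeasure lborel (U - B) \<le> ennreal (\<epsilon> - b)"
    using outer_regular_lborel_le[OF B, of "\<epsilon> - b"] b by auto
  have U_le: "emeasure lborel U \<le> ennreal \<epsilon>"
  proof -
    have "emeasure lborel U = emeasure lborel (B \<union> (U - B))" using U(2) by (simp add: Un_absorb1)
    also have "\<dots> \<le> emeasure lborel B + emeasure lborel (U - B)"
      using U(1) by (intro emeasure_subadditive) auto
    also have "\<dots> \<le> ennreal b + ennreal (\<epsilon> - b)" using U(3) b by (intro add_mono) auto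
    also have "\<dots> = ennreal \<epsilon>" using b by (simp flip: ennreal_plus)
    finally show ?thesis .
  qed
  \<comment> \<open>A dyadic subdivision: half-open intervals of one stage are disjoint, and each
    splits into two of the next stage, so the sets \<open>V n\<close> increase. As \<open>U\<close>
    is open, every point of \<open>B\<close> eventually lies in an interval contained in
    \<open>U\<close>.\<close>
  define L :: "nat \<Rightarrow> real" where "L = (\<lambda>n. 2 * pi / 2 ^ n)"
  have L: "L n > 0" for n by (simp add: L_def)
  define I where "I = (\<lambda>n k. {real k * L n..<(real k + 1) * L n})"
  define J where "J = (\<lambda>n. {k. k < 2 ^ n \<and> I n k \<subseteq> U})"
  define V where "V = (\<lambda>n. {z \<in> sphere 0 1. \<exists>k\<in>J n. Arg2pi z \<in> I n k})"
  have I_iff: "x \<in> I n k \<longleftrightarrow> \<lfloor>x / L n\<rfloor> = int k" for x n k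
    using L[of n] by (auto simp: I_def floor_eq_iff field_simps)
  have finJ: "finite (J n)" for n by (simp add: J_def)
  show ?thesis
  proof (rule that[of V J L])
    fix n
    show "finite (J n)" "L n > 0" by (rule finJ L)+
    have "V n = (\<Union>k\<in>J n. {z \<in> space borel. Arg2pi z \<in> I n k}) \<inter> sphere 0 1" by (auto simp: V_def)
    moreover have "(\<Union>k\<in>J n. {z \<in> space borel. Arg2pi z \<in> I n k}) \<in> sets borel"
      using finJ borel_measurable_Arg2pi by (intro sets.finite_UN) (auto simp: I_def)
    ultimately have "V n \<in> sets (restrict_space borel (sphere 0 1))"
      by (auto simp: sets_restrict_space)
    then show "V n \<in> sets circle_measure"
      unfolding circle_measure_def by (intro sets_completionI_sets) auto
    have "disjoint_family_on (I n) (J n)"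
      unfolding disjoint_family_on_def using I_iff by fastforce
    then have "(\<Sum>k\<in>J n. emeasure lborel (I n k)) = emeasure lborel (\<Union>k\<in>J n. I n k)"
      using finJ by (intro sum_emeasure) (auto simp: I_def)
    also have "\<dots> \<le> emeasure lborel U"
      using U(1) by (intro emeasure_mono) (auto simp: J_def)
    also note U_le
    also have "(\<Sum>k\<in>J n. emeasure lborel (I n k)) = (\<Sum>k\<in>J n. ennreal (L n))"
      using L[of n] by (intro sum.cong refl) (simp add: I_def algebra_simps)
    also have "\<dots> = ennreal (card (J n) * L n)"
      using L[of n] by (subst sum_ennreal) (auto simp: less_imp_le)
    finally show "card (J n) * L n \<le> \<epsilon>" using \<epsilon> by (simp add: ennreal_le_iff)
  next
    fix n z assume "z \<in> V n"
    then obtain k where k: "norm z = 1" "k \<in> J n" "Arg2pi z \<in> I n k" by (auto simp: V_def)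
    have "dist z (cis (real k * L n)) = norm (cis (Arg2pi z) - cis (real k * L n))"
      by (simp add: dist_norm cis_Arg2pi[OF k(1)])
    also have "\<dots> \<le> \<bar>Arg2pi z - real k * L n\<bar>" by (rule norm_cis_diff_le)
    also have "\<dots> \<le> L n" using k(3) by (auto simp: I_def algebra_simps)
    finally show "norm z = 1 \<and> (\<exists>k\<in>J n. dist z (cis (real k * L n)) \<le> L n)" using k by blast
  next
    show "incseq V"
    proof (rule incseq_SucI, rule subsetI)
      fix n z assume "z \<in> V n"
      then obtain k where k: "z \<in> sphere 0 1" "k \<in> J n" "Arg2pi z \<in> I n k" by (auto simp: V_def)
      have LS: "L n = 2 * L (Suc n)" by (simp add: L_def)
      define j where "j = (if Arg2pi z < real (2 * k + 1) * L (Suc n) then 2 * k else 2 * k + 1)"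
      have sub: "I (Suc n) j \<subseteq> I n k"
        using L[of "Suc n"] by (auto simp: I_def LS j_def algebra_simps split: if_splits)
      have "Arg2pi z \<in> I (Suc n) j" using k(3) by (auto simp: I_def LS j_def algebra_simps)
      moreover have "j \<in> J (Suc n)" using sub k(2) by (auto simp: J_def j_def)
      ultimately show "z \<in> V (Suc n)" using k(1) by (auto simp: V_def)
    qed
    show "A \<subseteq> (\<Union>n. V n)"
    proof
      fix z assume z: "z \<in> A"
      define \<theta> where "\<theta> = Arg2pi z"
      have \<theta>: "0 \<le> \<theta>" "\<theta> < 2 * pi" using Arg2pi[of z] by (auto simp: \<theta>_def)
      have nz: "norm z = 1" using z sets.sets_into_space[OF A] by auto
      have "\<theta> \<in> B" using z A'(2) \<theta> cis_Arg2pi[OF nz] by (auto simp: B_def \<theta>_def)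
      then obtain d where d: "d > 0" "\<And>x. dist x \<theta> < d \<Longrightarrow> x \<in> U"
        using U(1,2) unfolding open_dist by blast
      have "(\<lambda>n. 2 * pi * (1 / 2) ^ n) \<longlonglongrightarrow> 2 * pi * 0"
        by (intro tendsto_mult tendsto_const LIMSEQ_power_zero) auto
      then have "\<forall>\<^sub>F n in sequentially. L n < d"
        using d(1) by (auto simp: L_def power_divide dest: order_tendstoD(2))
      then obtain n where n: "L n < d" by (auto simp: eventually_sequentially)
      define k where "k = nat \<lfloor>\<theta> / L n\<rfloor>"
      have kI: "\<theta> \<in> I n k" using \<theta> L[of n] by (simp add: I_iff k_def)
      then have "real k * L n < 2 ^ n * L n" using \<theta> by (auto simp: I_def L_def)
      then have "real k < 2 ^ n" using L[of n] by simp
      then have "k < 2 ^ n" by (metis of_nat_less_iff of_nat_numeral of_nat_power)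
      moreover have "I n k \<subseteq> U"
      proof
        fix x assume "x \<in> I n k"
        then have "\<bar>x - \<theta>\<bar> < d" using kI n by (auto simp: I_def algebra_simps abs_if)
        then show "x \<in> U" using d(2) by (simp add: dist_real_def)
      qed
      ultimately have "k \<in> J n" by (simp add: J_def)
      then show "z \<in> (\<Union>n. V n)" using kI nz by (auto simp: V_def \<theta>_def)
    qed
  qed
qed

section \<open>Integrals of the monomials\<close>

lemma integral_circle_measure:
  fixes f :: "complex \<Rightarrow> complex"
  assumes [measurable]: "f \<in> borel_measurable borel"
  shows "integral\<^sup>L circle_measure f = (LINT \<theta>|lborel. indicator {0..<2 * pi} \<theta> *\<^sub>R f (cis \<theta>)) / (2 * pi)"
proof -
  have cis[measurable]: "cis \<in> borel_measurable borel"
    by (intro borel_measurable_continuous_onI continuous_intros)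
  have 1: "integral\<^sup>L circle_measure f =
      integral\<^sup>L (uniform_measure lborel {0..<2 * pi}) (\<lambda>\<theta>. f (cis \<theta>))"
    unfolding circle_measure_def
    by (subst integral_completion, simp add: measurable_restrict_space1, subst integral_distr[OF cis_measurable_circle])
       (auto simp: measurable_restrict_space1)
  have "1 / ennreal (2 * pi) = ennreal (1 / (2 * pi))"
    using divide_ennreal[of 1 "2 * pi"] by simp
  then have "uniform_measure lborel {0..<2 * pi} =
      density lborel (\<lambda>\<theta>. ennreal (indicator {0..<2 * pi} \<theta> / (2 * pi)))"
    unfolding uniform_measure_def
    by (intro density_cong) (auto split: split_indicator)
  then have "integral\<^sup>L (uniform_measure lborel {0..<2 * pi}) (\<lambda>\<theta>. f (cis \<theta>)) =
      integral\<^sup>L (density lborel (\<lambda>\<theta>. ennreal (indicator {0..<2 * pi} \<theta> / (2 * pi)))) (\<lambda>\<theta>. f (cis \<theta>))"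
    by simp
  also have "\<dots> = (LINT \<theta>|lborel. (indicator {0..<2 * pi} \<theta> / (2 * pi)) *\<^sub>R f (cis \<theta>))"
    by (subst integral_density) auto
  also have "\<dots> = (LINT \<theta>|lborel. (indicator {0..<2 * pi} \<theta> *\<^sub>R f (cis \<theta>)) / (2 * pi))"
    by (rule Bochner_Integration.integral_cong) (auto simp: scaleR_conv_of_real)
  finally show ?thesis by (simp add: 1)
qed

lemma integral_power_int_circle:
  "integral\<^sup>L circle_measure (\<lambda>z. z powi k) = (if k = 0 then 1 else 0)"
proof -
  interpret prob_space circle_measure by (rule prob_space_circle_measure)
  show ?thesis
  proof (cases "k = 0")
    case True
    then show ?thesis by (simp add: prob_space[unfolded space_circle_measure])
  next
    case False
    have meas: "(\<lambda>z::complex. z powi k) \<in> borel_measurable borel"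
      by (cases "k \<ge> 0") (auto simp: power_int_def)
    have [measurable]: "(\<lambda>\<theta>. cis (real_of_int k * \<theta>)) \<in> borel_measurable borel"
      by (intro borel_measurable_continuous_onI continuous_intros)
    have "(LINT \<theta>|lborel. indicator {0..<2 * pi} \<theta> *\<^sub>R (cis \<theta> powi k)) =
        (LINT \<theta>|lborel. indicator {0..2 * pi} \<theta> *\<^sub>R cis (real_of_int k * \<theta>))"
    proof (rule integral_cong_AE)
      show "AE \<theta> in lborel. indicator {0..<2 * pi} \<theta> *\<^sub>R cis \<theta> powi k =
          indicator {0..2 * pi} \<theta> *\<^sub>R cis (real_of_int k * \<theta>)"
        using AE_lborel_singleton[of "2 * pi"]
        by eventually_elim (auto simp: cis_power_int split: split_indicator)
    qed (auto simp: cis_power_int)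
    also have "\<dots> = cis (real_of_int k * (2 * pi)) / (\<i> * k) - cis (real_of_int k * 0) / (\<i> * k)"
      using False
      by (intro integral_FTC_Icc)
         (auto intro!: continuous_intros derivative_eq_intros
            simp: has_vector_derivative_def scaleR_conv_of_real fun_eq_iff complex_eq_iff)
    also have "cis (real_of_int k * (2 * pi)) = 1"
      using cis_multiple_2pi[of "real_of_int k"] by (simp add: mult.commute)
    finally show ?thesis
      using False by (subst integral_circle_measure[OF meas]) simp
  qed
qed

section \<open>Absolute continuity of the norm\<close>

lemma ennreal_add_less_half:
  assumes "a < ennreal (e / 2)" "b \<le> ennreal (e / 2)" "e > 0"
  shows "a + b < ennreal e"
proof -
  have "a + b \<le> a + ennreal (e / 2)" using assms(2) by (rule add_left_mono)
  also have "\<dots> < ennreal (e / 2) + ennreal (e / 2)"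
    using assms(1) by (subst (1 2) add.commute[of _ "ennreal (e / 2)"]) (simp add: ennreal_add_left_cancel_less)
  also have "\<dots> = ennreal e" using assms(3) by (simp flip: ennreal_plus)
  finally show ?thesis .
qed

text \<open>Collects what the approximation arguments use about a norm, in a form that can be
  verified both for \<rho> and for \<open>associate_norm \<rho>\<close>.\<close>

locale circle_lattice_norm =
  fixes \<rho> :: "(complex \<Rightarrow> ennreal) \<Rightarrow> ennreal"
  assumes mono: "\<And>f g. f \<in> borel_measurable circle_measure \<Longrightarrow> g \<in> borel_measurable circle_measure \<Longrightarrow>
      (AE t in circle_measure. g t \<le> f t) \<Longrightarrow> \<rho> g \<le> \<rho> f"
    and cmult: "\<And>f c. f \<in> borel_measurable circle_measure \<Longrightarrow> c \<ge> 0 \<Longrightarrow>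
      \<rho> (\<lambda>t. ennreal c * f t) = ennreal c * \<rho> f"
    and subadd: "\<And>f g. f \<in> borel_measurable circle_measure \<Longrightarrow> g \<in> borel_measurable circle_measure \<Longrightarrow>
      \<rho> (\<lambda>t. f t + g t) \<le> \<rho> f + \<rho> g"
    and one_finite: "\<rho> (\<lambda>_. 1) < \<infinity>"
begin

lemma bfs_norm_mono:
  assumes "f \<in> borel_measurable circle_measure" "g \<in> borel_measurable circle_measure"
    "\<And>t. norm t = 1 \<Longrightarrow> norm (g t) \<le> norm (f t)"
  shows "bfs_norm \<rho> g \<le> bfs_norm \<rho> f"
  unfolding bfs_norm_def using assms by (intro mono AE_I2) auto

lemma bfs_norm_add:
  assumes "f \<in> borel_measurable circle_measure" "g \<in> borel_measurable circle_measure"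
  shows "bfs_norm \<rho> (\<lambda>t. f t + g t) \<le> bfs_norm \<rho> f + bfs_norm \<rho> g"
proof -
  note [measurable] = assms
  have "bfs_norm \<rho> (\<lambda>t. f t + g t) \<le> \<rho> (\<lambda>t. ennreal (norm (f t)) + ennreal (norm (g t)))"
    unfolding bfs_norm_def by (intro mono AE_I2) (auto simp: norm_triangle_ineq simp flip: ennreal_plus)
  also have "\<dots> \<le> bfs_norm \<rho> f + bfs_norm \<rho> g"
    unfolding bfs_norm_def by (intro subadd) auto
  finally show ?thesis .
qed

lemma bfs_norm_le_cmult:
  assumes "f \<in> borel_measurable circle_measure" "g \<in> borel_measurable circle_measure" "K \<ge> 0"
    "\<And>t. norm t = 1 \<Longrightarrow> norm (g t) \<le> K * norm (f t)"
  shows "bfs_norm \<rho> g \<le> ennreal K * bfs_norm \<rho> f"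
proof -
  note [measurable] = assms(1,2)
  have "bfs_norm \<rho> g \<le> \<rho> (\<lambda>t. ennreal K * ennreal (norm (f t)))"
    unfolding bfs_norm_def using assms by (intro mono AE_I2) (auto simp flip: ennreal_mult)
  also have "\<dots> = ennreal K * bfs_norm \<rho> f"
    unfolding bfs_norm_def using assms(3) by (intro cmult) auto
  finally show ?thesis .
qed

definition norm_one :: real where "norm_one = enn2real (\<rho> (\<lambda>_. 1))"

lemma norm_one: "norm_one \<ge> 0" "bfs_norm \<rho> (\<lambda>_. 1) = ennreal norm_one"
  using one_finite by (auto simp: norm_one_def bfs_norm_def)

lemma bfs_norm_bounded:
  assumes "g \<in> borel_measurable circle_measure" "K \<ge> 0" "\<And>t. norm t = 1 \<Longrightarrow> norm (g t) \<le> K"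
  shows "bfs_norm \<rho> g \<le> ennreal (K * norm_one)"
  using bfs_norm_le_cmult[of "\<lambda>_. 1" g K] assms norm_one by (simp add: ennreal_mult)

lemma bounded_in_bfs:
  assumes "g \<in> borel_measurable circle_measure" "\<And>t. norm t = 1 \<Longrightarrow> norm (g t) \<le> K"
  shows "g \<in> bfs \<rho>"
proof -
  have "bfs_norm \<rho> g \<le> ennreal (max 0 K * norm_one)"
    using assms by (intro bfs_norm_bounded) (auto simp: le_max_iff_disj)
  then show ?thesis using assms(1) by (auto simp: bfs_def intro: le_less_trans)
qed

end

lemma bounded_simple_approx:
  fixes f :: "complex \<Rightarrow> complex"
  assumes [measurable]: "f \<in> borel_measurable circle_measure"
    and bd: "\<And>t. norm t = 1 \<Longrightarrow> norm (f t) \<le> K" and "e > 0"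
  obtains s where "simple_function circle_measure s" "\<And>t. norm t = 1 \<Longrightarrow> norm (f t - s t) \<le> e"
proof -
  define d where "d = e / 2"
  have d: "d > 0" using assms(3) by (simp add: d_def)
  \<comment> \<open>Rounding down to multiples of \<open>d\<close> leaves a bounded function with
    finitely many values. The error \<open>d = e / 2\<close> is spent once on the real and once on
    the imaginary part.\<close>
  define r where "r = (\<lambda>x::real. d * of_int \<lfloor>x / d\<rfloor>)"
  have r: "\<bar>x - r x\<bar> \<le> d" for x
  proof -
    have "x = d * (x / d)" using d by simp
    then have "x - r x = d * frac (x / d)" by (metis r_def frac_def right_diff_distrib)
    moreover have "0 \<le> d * frac (x / d)" "d * frac (x / d) \<le> d * 1"
      using d frac_lt_1[of "x / d"] by (auto intro!: mult_left_mono simp del: mult_1_right)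
    ultimately show ?thesis by simp
  qed
  have simp_r: "simple_function circle_measure (\<lambda>t. r (g t))"
    if [measurable]: "g \<in> borel_measurable circle_measure" and g: "\<And>t. norm t = 1 \<Longrightarrow> \<bar>g t\<bar> \<le> K" for g
  proof (rule simple_function_borel_measurable)
    show "(\<lambda>t. r (g t)) \<in> borel_measurable circle_measure" unfolding r_def by measurable
    have "(\<lambda>t. r (g t)) ` space circle_measure \<subseteq> (\<lambda>j. d * of_int j) ` {\<lfloor>- K / d\<rfloor>..\<lfloor>K / d\<rfloor>}"
    proof safe
      fix t assume "t \<in> space circle_measure"
      then have "\<bar>g t\<bar> \<le> K" using g by simp
      then have "- K / d \<le> g t / d" "g t / d \<le> K / d" using d by (intro divide_right_mono; linarith)+
      then show "r (g t) \<in> (\<lambda>j. d * of_int j) ` {\<lfloor>- K / d\<rfloor>..\<lfloor>K / d\<rfloor>}"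
        unfolding r_def by (intro imageI) (auto intro: floor_mono)
    qed
    then show "finite ((\<lambda>t. r (g t)) ` space circle_measure)"
      by (rule finite_subset) auto
  qed
  define s where "s = (\<lambda>t. Complex (r (Re (f t))) (r (Im (f t))))"
  show ?thesis
  proof (rule that[of s])
    show "simple_function circle_measure s"
      unfolding s_def
      using bd by (intro simple_function_compose2[OF simp_r simp_r])
        (auto intro: order_trans[OF abs_Re_le_cmod] order_trans[OF abs_Im_le_cmod])
    fix t :: complex
    have "norm (f t - s t) \<le> \<bar>Re (f t - s t)\<bar> + \<bar>Im (f t - s t)\<bar>" by (rule cmod_le)
    also have "\<dots> \<le> e" using r[of "Re (f t)"] r[of "Im (f t)"] by (simp add: s_def d_def)
    finally show "norm (f t - s t) \<le> e" .
  qed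
qed

context circle_lattice_norm
begin

text \<open>The sets on which \<open>norm (f t) > real n\<close> shrink to the empty set because
  \<open>f\<close> is finite everywhere, so absolute continuity makes the part of \<open>f\<close>
  over them small in norm. What remains is bounded, hence uniformly close to a simple
  function.\<close>

lemma abs_cont_part_subset: "abs_cont_part \<rho> \<subseteq> simple_closure \<rho>"
proof
  fix f assume f: "f \<in> abs_cont_part \<rho>"
  then have fb: "f \<in> bfs \<rho>" by (simp add: abs_cont_part_def)
  then have fm[measurable]: "f \<in> borel_measurable circle_measure" by (simp add: bfs_def)
  define \<gamma> where "\<gamma> = (\<lambda>n::nat. {t \<in> space circle_measure. norm (f t) > real n})"
  have \<gamma>[measurable]: "\<gamma> n \<in> sets circle_measure" for n unfolding \<gamma>_def by measurable
  have lim: "(\<lambda>n. indicator (\<gamma> n) t :: real) \<longlonglongrightarrow> 0" for t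
  proof (rule tendsto_eventually)
    show "\<forall>\<^sub>F n in sequentially. indicator (\<gamma> n) t = (0::real)"
      using eventually_ge_at_top[of "nat \<lceil>norm (f t)\<rceil>"]
      by eventually_elim (auto simp: \<gamma>_def indicator_def nat_le_iff ceiling_le_iff)
  qed
  have "\<exists>s. simple_function circle_measure s \<and> bfs_norm \<rho> (\<lambda>t. f t - s t) < ennreal \<epsilon>" if \<epsilon>: "\<epsilon> > 0" for \<epsilon> :: real
  proof -
    have "(\<lambda>n. bfs_norm \<rho> (\<lambda>t. f t * indicator (\<gamma> n) t)) \<longlonglongrightarrow> 0"
      using f \<gamma> lim by (auto simp: abs_cont_part_def)
    then have "\<forall>\<^sub>F n in sequentially. bfs_norm \<rho> (\<lambda>t. f t * indicator (\<gamma> n) t) < ennreal (\<epsilon> / 2)"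
      by (rule order_tendstoD) (use \<epsilon> in simp)
    then obtain n where n: "bfs_norm \<rho> (\<lambda>t. f t * indicator (\<gamma> n) t) < ennreal (\<epsilon> / 2)"
      by (auto simp: eventually_sequentially)
    define g where "g = (\<lambda>t. f t * indicator (- \<gamma> n) t)"
    have g[measurable]: "g \<in> borel_measurable circle_measure"
    proof -
      have "(\<lambda>t. if t \<in> \<gamma> n then 0 else f t) \<in> borel_measurable circle_measure" by measurable
      moreover have "(\<lambda>t. if t \<in> \<gamma> n then 0 else f t) = g" by (auto simp: g_def indicator_def)
      ultimately show ?thesis by simp
    qed
    \<comment> \<open>The summand 1 avoids a division by zero when
      \<open>norm_one = 0\<close>.\<close>
    define e where "e = \<epsilon> / (2 * (norm_one + 1))"
    have e: "e > 0" using \<epsilon> norm_one(1) by (simp add: e_def)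
    obtain s where s: "simple_function circle_measure s" "\<And>t. norm t = 1 \<Longrightarrow> norm (g t - s t) \<le> e"
      by (rule bounded_simple_approx[OF g _ e, of "real n"]) (auto simp: g_def \<gamma>_def indicator_def)
    have [measurable]: "s \<in> borel_measurable circle_measure"
      using s(1) by (rule borel_measurable_simple_function)
    have "bfs_norm \<rho> (\<lambda>t. f t - s t) = bfs_norm \<rho> (\<lambda>t. f t * indicator (\<gamma> n) t + (g t - s t))"
      by (rule arg_cong[where f = "bfs_norm \<rho>"]) (auto simp: g_def indicator_def)
    also have "\<dots> \<le> bfs_norm \<rho> (\<lambda>t. f t * indicator (\<gamma> n) t) + bfs_norm \<rho> (\<lambda>t. g t - s t)"
      by (rule bfs_norm_add) measurable
    also have "\<dots> < ennreal \<epsilon>"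
    proof (rule ennreal_add_less_half[OF n _ \<epsilon>])
      have "bfs_norm \<rho> (\<lambda>t. g t - s t) \<le> ennreal (e * norm_one)"
        using e s by (intro bfs_norm_bounded) auto
      also have "e * norm_one \<le> \<epsilon> / 2"
        using norm_one(1) \<epsilon> by (simp add: e_def field_simps)
      finally show "bfs_norm \<rho> (\<lambda>t. g t - s t) \<le> ennreal (\<epsilon> / 2)" by (simp add: ennreal_leI)
    qed
    finally show ?thesis using s(1) by blast
  qed
  then show "f \<in> simple_closure \<rho>" using fb by (auto simp: simple_closure_def)
qed

end

text \<open>The condition \<open>small_sets\<close> expresses absolute continuity of the norm
  through the measure of a set instead of sequences of sets. This is the form that the logarithmic
  test functions deliver.\<close>

locale abs_cont_circle_norm = circle_lattice_norm +
  assumes small_sets: "\<And>e::real. e > 0 \<Longrightarrow> \<exists>d>0. \<forall>A\<in>sets circle_measure.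
    emeasure circle_measure A < ennreal d \<longrightarrow> \<rho> (indicator A) < ennreal e"
begin

text \<open>Dominated convergence turns convergence of the indicators almost everywhere into
  convergence of the measures to 0.\<close>

lemma indicator_norm_tendsto:
  assumes [measurable]: "\<And>n. \<gamma> n \<in> sets circle_measure"
    and lim: "AE t in circle_measure. (\<lambda>n. indicator (\<gamma> n) t :: real) \<longlonglongrightarrow> 0"
  shows "(\<lambda>n. \<rho> (indicator (\<gamma> n))) \<longlonglongrightarrow> 0"
proof (rule tendsto_zero_ennreal)
  interpret prob_space circle_measure by (rule prob_space_circle_measure)
  fix e :: real assume "e > 0"
  then obtain d where d: "d > 0" "\<And>A. A \<in> sets circle_measure \<Longrightarrow>
      emeasure circle_measure A < ennreal d \<Longrightarrow> \<rho> (indicator A) < ennreal e"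
    using small_sets by blast
  have "(\<lambda>n. LINT t|circle_measure. indicator (\<gamma> n) t :: real) \<longlonglongrightarrow> (LINT t|circle_measure. 0)"
    by (rule integral_dominated_convergence[where w = "\<lambda>_. 1"]) (use lim in auto)
  then have "(\<lambda>n. measure circle_measure (\<gamma> n)) \<longlonglongrightarrow> 0"
    by (simp add: sets.Int_space_eq2[OF assms(1), simplified])
  then have "\<forall>\<^sub>F n in sequentially. measure circle_measure (\<gamma> n) < d"
    by (rule order_tendstoD) (rule d(1))
  then show "\<forall>\<^sub>F n in sequentially. \<rho> (indicator (\<gamma> n)) < ennreal e"
    by eventually_elim (auto intro!: d(2) simp: emeasure_eq_measure ennreal_less_iff)
qed

text \<open>Write \<open>f = (f - s) + s\<close> with \<open>s\<close> simple. Over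
  \<open>\<gamma> n\<close> the first part is small uniformly in \<open>n\<close>; the second is
  bounded, as a simple function takes finitely many values, and is therefore controlled by the norm
  of the indicator of \<open>\<gamma> n\<close>.\<close>

lemma abs_cont_part_eq: "abs_cont_part \<rho> = simple_closure \<rho>"
proof (rule antisym[OF abs_cont_part_subset], rule subsetI)
  fix f assume f: "f \<in> simple_closure \<rho>"
  then have fb: "f \<in> bfs \<rho>" by (simp add: simple_closure_def)
  then have fm[measurable]: "f \<in> borel_measurable circle_measure" by (simp add: bfs_def)
  have "(\<lambda>n. bfs_norm \<rho> (\<lambda>t. f t * indicator (\<gamma> n) t)) \<longlonglongrightarrow> 0"
    if \<gamma>[measurable]: "\<And>n. \<gamma> n \<in> sets circle_measure"
      and lim: "AE t in circle_measure. (\<lambda>n. indicator (\<gamma> n) t :: real) \<longlonglongrightarrow> 0" for \<gamma> :: "nat \<Rightarrow> complex set"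
  proof (rule tendsto_zero_ennreal)
    fix \<epsilon> :: real assume \<epsilon>: "\<epsilon> > 0"
    then have "\<epsilon> / 2 > 0" by simp
    then obtain s where s: "simple_function circle_measure s" "bfs_norm \<rho> (\<lambda>t. f t - s t) < ennreal (\<epsilon> / 2)"
      using f unfolding simple_closure_def by blast
    have [measurable]: "s \<in> borel_measurable circle_measure"
      using s(1) by (rule borel_measurable_simple_function)
    have "finite (s ` sphere 0 1)" using simple_functionD(1)[OF s(1)] by simp
    then have "bounded (s ` sphere 0 1)" by (rule finite_imp_bounded)
    then obtain K where K: "K > 0" "\<And>t. norm t = 1 \<Longrightarrow> norm (s t) \<le> K"
      by (auto simp: bounded_pos)
    have "\<forall>\<^sub>F n in sequentially. \<rho> (indicator (\<gamma> n)) < ennreal (\<epsilon> / (2 * K))"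
      using indicator_norm_tendsto[OF \<gamma> lim] by (rule order_tendstoD) (use \<epsilon> K in simp)
    then show "\<forall>\<^sub>F n in sequentially. bfs_norm \<rho> (\<lambda>t. f t * indicator (\<gamma> n) t) < ennreal \<epsilon>"
    proof eventually_elim
      case (elim n)
      have "bfs_norm \<rho> (\<lambda>t. f t * indicator (\<gamma> n) t) =
          bfs_norm \<rho> (\<lambda>t. (f t - s t) * indicator (\<gamma> n) t + s t * indicator (\<gamma> n) t)"
        by (simp add: algebra_simps)
      also have "\<dots> \<le> bfs_norm \<rho> (\<lambda>t. (f t - s t) * indicator (\<gamma> n) t) + bfs_norm \<rho> (\<lambda>t. s t * indicator (\<gamma> n) t)"
        by (rule bfs_norm_add) measurable
      also have "\<dots> \<le> bfs_norm \<rho> (\<lambda>t. f t - s t) + ennreal K * bfs_norm \<rho> (indicator (\<gamma> n))"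
        using K by (intro add_mono bfs_norm_mono bfs_norm_le_cmult) (auto simp: indicator_def)
      also have "bfs_norm \<rho> (indicator (\<gamma> n)) = \<rho> (indicator (\<gamma> n))"
        unfolding bfs_norm_def by (rule arg_cong[where f = \<rho>]) (auto simp: indicator_def)
      also have "bfs_norm \<rho> (\<lambda>t. f t - s t) + ennreal K * \<rho> (indicator (\<gamma> n)) < ennreal \<epsilon>"
      proof (rule ennreal_add_less_half[OF s(2) _ \<epsilon>])
        have "ennreal K * \<rho> (indicator (\<gamma> n)) \<le> ennreal K * ennreal (\<epsilon> / (2 * K))"
          using elim by (intro mult_left_mono) auto
        also have "\<dots> = ennreal (\<epsilon> / 2)" using K \<epsilon> by (simp flip: ennreal_mult)
        finally show "ennreal K * \<rho> (indicator (\<gamma> n)) \<le> ennreal (\<epsilon> / 2)" .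
      qed
      finally show ?case .
    qed
  qed
  then show "f \<in> abs_cont_part \<rho>" using fb by (auto simp: abs_cont_part_def)
qed

end

section \<open>Density of trigonometric polynomials\<close>

text \<open>Agreement is asked on the circle only:
  \<open>z powi k * z powi l = z powi (k + l)\<close> can fail at 0, and conjugation is a power of
  \<open>z\<close> only where \<open>norm z = 1\<close>.\<close>

definition trig_on_circle :: "(complex \<Rightarrow> complex) \<Rightarrow> bool" where
  "trig_on_circle f \<longleftrightarrow> (\<exists>p q. trig_poly p q \<and> (\<forall>z. norm z = 1 \<longrightarrow> f z = p z))"

lemma trig_on_circleI: "trig_poly p q \<Longrightarrow> (\<And>z. norm z = 1 \<Longrightarrow> f z = p z) \<Longrightarrow> trig_on_circle f"
  unfolding trig_on_circle_def by blast

lemma trig_on_circle_add: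
  "trig_on_circle f \<Longrightarrow> trig_on_circle g \<Longrightarrow> trig_on_circle (\<lambda>z. f z + g z)"
  unfolding trig_on_circle_def using trig_poly.add by (metis (no_types, lifting))

lemma trig_on_circle_monom: "trig_on_circle (\<lambda>z. c * z powi k)"
  using trig_poly.monom by (rule trig_on_circleI) auto

lemma trig_on_circle_cong:
  "trig_on_circle f \<Longrightarrow> (\<And>z. norm z = 1 \<Longrightarrow> g z = f z) \<Longrightarrow> trig_on_circle g"
  unfolding trig_on_circle_def by metis

lemma trig_on_circle_const: "trig_on_circle (\<lambda>_. c)"
  using trig_on_circle_monom[of c 0] by simp

lemma trig_on_circle_mult:
  assumes "trig_on_circle f" "trig_on_circle g"
  shows "trig_on_circle (\<lambda>z. f z * g z)"
proof -
  have monom_mult: "trig_on_circle (\<lambda>z. c * z powi k * p' z)" if "trig_poly p' q'" for c k p' q'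
    using that
  proof induction
    case (monom c' k')
    show ?case
    proof (rule trig_on_circle_cong[OF trig_on_circle_monom[of "c * c'" "k + k'"]])
      fix z :: complex assume "norm z = 1"
      then have "z \<noteq> 0" by auto
      then show "c * z powi k * (c' * z powi k') = c * c' * z powi (k + k')"
        by (simp add: power_int_add)
    qed
  next
    case (add p q p' q')
    then show ?case by (auto intro: trig_on_circle_cong[OF trig_on_circle_add] simp: distrib_left)
  qed
  obtain p' q' where p': "trig_poly p' q'" "\<And>z. norm z = 1 \<Longrightarrow> g z = p' z"
    using assms(2) unfolding trig_on_circle_def by blast
  have "trig_on_circle (\<lambda>z. p z * p' z)" if "trig_poly p q" for p q
    using that
  proof induction
    case (monom c k)
    then show ?case using monom_mult[OF p'(1), of c k] .
  next
    case (add p q p' q')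
    then show ?case by (auto intro: trig_on_circle_cong[OF trig_on_circle_add] simp: distrib_right)
  qed
  then show ?thesis
    using assms(1) p'(2) unfolding trig_on_circle_def by (metis (no_types, lifting))
qed

lemma trig_on_circle_real_polynomial_function:
  fixes f :: "complex \<Rightarrow> real"
  assumes "real_polynomial_function f"
  shows "trig_on_circle (\<lambda>z. of_real (f z))"
  using assms
proof induction
  case (linear f)
  interpret bounded_linear f by fact
  \<comment> \<open>The coefficients come from \<open>f z = Re z * f 1 + Im z * f \<i>\<close>
    together with \<open>Re z = (z + inverse z) / 2\<close> and
    \<open>Im z = (z - inverse z) / (2 * \<i>)\<close> on the circle.\<close>
  have "trig_on_circle (\<lambda>z. Complex (f 1 / 2) (- f \<i> / 2) * z powi 1 + Complex (f 1 / 2) (f \<i> / 2) * z powi (-1))"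
    by (intro trig_on_circle_add trig_on_circle_monom)
  then show ?case
  proof (rule trig_on_circle_cong)
    fix z :: complex assume z: "norm z = 1"
    have "f z = f (Re z *\<^sub>R 1 + Im z *\<^sub>R \<i>)"
      by (rule arg_cong[where f = f]) (simp add: complex_eq_iff)
    also have "\<dots> = Re z * f 1 + Im z * f \<i>" by (simp only: add scaleR) simp
    finally have "f z = Re z * f 1 + Im z * f \<i>" .
    moreover have "z powi (-1) = cnj z" using norm_1_inverse_eq_cnj[OF z] by (simp add: power_int_minus)
    ultimately show "complex_of_real (f z) = Complex (f 1 / 2) (- f \<i> / 2) * z powi 1 + Complex (f 1 / 2) (f \<i> / 2) * z powi (-1)"
      by (simp add: complex_eq_iff)
  qed
next
  case (const c)
  show ?case by (rule trig_on_circle_const)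
next
  case (add f g)
  then show ?case by (simp add: trig_on_circle_add)
next
  case (mult f g)
  then show ?case by (simp add: trig_on_circle_mult)
qed

lemma trig_poly_measurable:
  assumes "trig_poly p q"
  shows "p \<in> borel_measurable borel" "q \<in> borel_measurable borel"
proof -
  have m: "(\<lambda>z::complex. z powi k) \<in> borel_measurable borel" for k
    by (cases "k \<ge> 0") (auto simp: power_int_def)
  have "p \<in> borel_measurable borel \<and> q \<in> borel_measurable borel"
    using assms by induction (use m in auto)
  then show "p \<in> borel_measurable borel" "q \<in> borel_measurable borel" by auto
qed

lemmas trig_poly_measurable_circle =
  trig_poly_measurable[THEN borel_measurable_circle]

lemma trig_poly_bounded:
  assumes "trig_poly p q"
  obtains B where "B > 0" "\<And>z. norm z = 1 \<Longrightarrow> norm (p z) \<le> B" "\<And>z. norm z = 1 \<Longrightarrow> norm (q z) \<le> B"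
proof -
  have "\<exists>B>0. \<forall>z. norm z = 1 \<longrightarrow> norm (p z) \<le> B \<and> norm (q z) \<le> B"
    using assms
  proof induction
    case (monom c k)
    show ?case by (rule exI[of _ "norm c + 1"]) (auto simp: norm_mult norm_power_int add_nonneg_pos)
  next
    case (add p q p' q')
    then obtain B B' where "B > 0" "B' > 0"
      "\<forall>z. norm z = 1 \<longrightarrow> norm (p z) \<le> B \<and> norm (q z) \<le> B"
      "\<forall>z. norm z = 1 \<longrightarrow> norm (p' z) \<le> B' \<and> norm (q' z) \<le> B'" by blast
    then show ?case
      by (intro exI[of _ "B + B'"]) (auto intro!: order_trans[OF norm_triangle_ineq] add_mono)
  qed
  then show ?thesis using that by blast
qed

text \<open>Regularity is applied to the image measure \<nu> on the Borel sets of the plane, which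
  agrees with \<open>circle_measure\<close> on Borel subsets of the circle. A set of the completion
  is first shrunk to a Borel set of the same measure, obtained as the complement of a hull of its
  complement.\<close>

lemma circle_inner_compact:
  assumes A: "A \<in> sets circle_measure" and d: "d > 0"
  obtains K where "compact K" "K \<subseteq> A" "measure circle_measure A < measure circle_measure K + d"
proof -
  interpret prob_space circle_measure by (rule prob_space_circle_measure)
  define base where "base = distr (uniform_measure lborel {0..<2 * pi}) (restrict_space borel (sphere 0 1)) cis"
  define \<nu> where "\<nu> = distr (uniform_measure lborel {0..<2 * pi}) (borel :: complex measure) cis"
  have cm: "circle_measure = completion base" by (simp add: circle_measure_def base_def)
  have cis: "cis \<in> measurable (uniform_measure lborel {0..<2 * pi}) borel"
    using measurable_restrict_space2_iff[of cis] cis_measurable_circle by simp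
  have \<nu>: "emeasure \<nu> S = emeasure circle_measure S" if "S \<in> sets borel" "S \<subseteq> sphere 0 1" for S
  proof -
    have S: "S \<in> sets base" using that by (auto simp: base_def sets_restrict_space)
    then have "emeasure circle_measure S = emeasure base S" by (simp add: cm emeasure_completion)
    also have "\<dots> = emeasure \<nu> S"
      unfolding base_def \<nu>_def using S that(1) cis
      by (subst (1 2) emeasure_distr) (auto simp: base_def cis_measurable_circle)
    finally show ?thesis ..
  qed
  obtain A2 where A2: "A2 \<in> sets base" "space circle_measure - A \<subseteq> A2"
    "emeasure circle_measure (space circle_measure - A) = emeasure base A2"
    using completion_upper[of "space circle_measure - A" base] A unfolding cm by blast
  define S where "S = sphere 0 1 - A2"
  have S: "S \<in> sets borel" "S \<subseteq> sphere 0 1" "S \<subseteq> A"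
    using A2(1,2) sets.sets_into_space[OF A] by (auto simp: S_def base_def sets_restrict_space)
  have A2cm: "A2 \<in> sets circle_measure" using A2(1) by (simp add: cm sets_completionI_sets)
  have "emeasure circle_measure A2 = emeasure base A2" using A2(1) by (simp add: cm emeasure_completion)
  then have "measure circle_measure A2 = measure circle_measure (space circle_measure - A)"
    using A2(3) by (simp add: measure_def)
  then have mS: "measure circle_measure S = measure circle_measure A"
    using prob_compl[OF A2cm] prob_compl[OF A] by (simp add: S_def)
  have "emeasure \<nu> (space \<nu>) \<noteq> \<infinity>"
  proof -
    have "prob_space \<nu>"
      unfolding \<nu>_def by (intro prob_space.prob_space_distr prob_space_uniform_measure cis) auto
    then show ?thesis by (simp add: prob_space.emeasure_space_1)
  qed
  then have "emeasure \<nu> S = (SUP K \<in> {K. K \<subseteq> S \<and> compact K}. emeasure \<nu> K)"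
    by (intro inner_regular S) (auto simp: \<nu>_def)
  show ?thesis
  \<comment> \<open>In the second case \<open>measure circle_measure A - d\<close> is nonnegative,
    so \<open>ennreal\<close> does not truncate it.\<close>
  proof (cases "measure circle_measure A < d")
    case True
    then show ?thesis using that[of "{}"] by simp
  next
    case False
    have "ennreal (measure circle_measure A - d) < emeasure \<nu> S"
      using d False by (simp add: \<nu>[OF S(1,2)] emeasure_eq_measure mS ennreal_less_iff)
    then obtain K where K: "K \<subseteq> S" "compact K" "ennreal (measure circle_measure A - d) < emeasure \<nu> K"
      unfolding \<open>emeasure \<nu> S = _\<close> by (auto simp: less_SUP_iff)
    have "K \<in> sets borel" using K(2) by (simp add: compact_imp_closed)
    then have "emeasure \<nu> K = ennreal (measure circle_measure K)"
      using \<nu>[of K] K(1) S(2) by (simp add: emeasure_eq_measure)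
    then have "measure circle_measure A < measure circle_measure K + d"
      using K(3) False by (simp add: ennreal_less_iff)
    then show ?thesis using that[of K] K S(3) by blast
  qed
qed

section \<open>Approximation of bounded functions in norm\<close>

context abs_cont_circle_norm
begin

definition approximable :: "(complex \<Rightarrow> complex) \<Rightarrow> bool" where
  "approximable f \<longleftrightarrow> f \<in> borel_measurable circle_measure \<and>
    (\<forall>e>0. \<exists>p q. trig_poly p q \<and> bfs_norm \<rho> (\<lambda>t. f t - p t) < ennreal e)"

lemma approximable_limit:
  assumes f: "f \<in> borel_measurable circle_measure"
    and g: "\<And>e. e > 0 \<Longrightarrow> \<exists>g. approximable g \<and> bfs_norm \<rho> (\<lambda>t. f t - g t) < ennreal e"
  shows "approximable f"
  unfolding approximable_def
proof (intro conjI allI impI f)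
  fix e :: real assume e: "e > 0"
  then obtain g where g: "approximable g" "bfs_norm \<rho> (\<lambda>t. f t - g t) < ennreal (e / 2)"
    using g[of "e / 2"] by auto
  then obtain p q where p: "trig_poly p q" "bfs_norm \<rho> (\<lambda>t. g t - p t) < ennreal (e / 2)"
    unfolding approximable_def using e by (meson half_gt_zero)
  note [measurable] = f trig_poly_measurable_circle[OF p(1)]
  have [measurable]: "g \<in> borel_measurable circle_measure" using g(1) by (simp add: approximable_def)
  have "bfs_norm \<rho> (\<lambda>t. f t - p t) \<le> bfs_norm \<rho> (\<lambda>t. f t - g t) + bfs_norm \<rho> (\<lambda>t. g t - p t)"
    using bfs_norm_add[of "\<lambda>t. f t - g t" "\<lambda>t. g t - p t"] by simp
  also have "\<dots> < ennreal e" using g(2) p(2) e by (intro ennreal_add_less_half) auto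
  finally show "\<exists>p q. trig_poly p q \<and> bfs_norm \<rho> (\<lambda>t. f t - p t) < ennreal e" using p(1) by blast
qed

lemma approximable_trig_on_circle:
  assumes "trig_on_circle f" "f \<in> borel_measurable circle_measure"
  shows "approximable f"
  unfolding approximable_def
proof (intro conjI allI impI assms(2))
  fix e :: real assume e: "e > 0"
  obtain p q where p: "trig_poly p q" "\<And>z. norm z = 1 \<Longrightarrow> f z = p z"
    using assms(1) unfolding trig_on_circle_def by blast
  note [measurable] = trig_poly_measurable_circle[OF p(1)] assms(2)
  have "bfs_norm \<rho> (\<lambda>t. f t - p t) \<le> ennreal (0 * norm_one)"
    by (rule bfs_norm_bounded) (auto simp: p(2))
  then have "bfs_norm \<rho> (\<lambda>t. f t - p t) < ennreal e" using e by simp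
  then show "\<exists>p q. trig_poly p q \<and> bfs_norm \<rho> (\<lambda>t. f t - p t) < ennreal e" using p(1) by blast
qed

lemma approximable_continuous:
  fixes g :: "complex \<Rightarrow> real"
  assumes g: "continuous_on UNIV g"
  shows "approximable (\<lambda>z. of_real (g z))"
proof (rule approximable_limit)
  have [measurable]: "g \<in> borel_measurable circle_measure"
    using g by (intro borel_measurable_circle borel_measurable_continuous_onI)
  show "(\<lambda>z. complex_of_real (g z)) \<in> borel_measurable circle_measure" by measurable
  fix e :: real assume e: "e > 0"
  define d where "d = e / (norm_one + 1)"
  have d: "d > 0" "d * norm_one < e" using e norm_one(1) by (auto simp: d_def field_simps)
  obtain h where h: "real_polynomial_function h" "\<And>x. x \<in> sphere 0 1 \<Longrightarrow> \<bar>g x - h x\<bar> < d"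
    by (rule Stone_Weierstrass_real_polynomial_function[of "sphere 0 1" g d])
       (use g d in \<open>auto intro: continuous_on_subset\<close>)
  have [measurable]: "h \<in> borel_measurable circle_measure"
    using h(1) by (intro borel_measurable_circle borel_measurable_continuous_onI
      continuous_on_polymonial_function) (simp add: real_polynomial_function_eq)
  have "approximable (\<lambda>z. of_real (h z))"
    using h(1) by (intro approximable_trig_on_circle trig_on_circle_real_polynomial_function) measurable
  moreover have "bfs_norm \<rho> (\<lambda>t. of_real (g t) - of_real (h t)) \<le> ennreal (d * norm_one)"
  proof (rule bfs_norm_bounded)
    fix t :: complex assume "norm t = 1"
    then have "\<bar>g t - h t\<bar> \<le> d" using h(2)[of t] by simp
    then show "norm (complex_of_real (g t) - complex_of_real (h t)) \<le> d"
      by (simp flip: of_real_diff)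
  qed (use d in auto)
  then have "bfs_norm \<rho> (\<lambda>t. of_real (g t) - of_real (h t)) < ennreal e"
    using d e norm_one(1) by (elim le_less_trans) (simp add: ennreal_less_iff)
  ultimately show "\<exists>h. approximable h \<and> bfs_norm \<rho> (\<lambda>t. of_real (g t) - h t) < ennreal e" by blast
qed

text \<open>Absolute continuity of the norm enters the density argument here. A continuous function
  that is 1 on a compact part of \<open>A\<close> and 0 on a compact part of the complement differs
  from the indicator only on a set \<open>D\<close> of small measure, and by at most 1 there. The
  difference need not be uniformly small, but the norm of the indicator of \<open>D\<close>
  is.\<close>

lemma approximable_indicator:
  assumes A[measurable]: "A \<in> sets circle_measure"
  shows "approximable (indicator A)"
proof (rule approximable_limit)
  interpret prob_space circle_measure by (rule prob_space_circle_measure)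
  show "indicator A \<in> borel_measurable circle_measure" by measurable
  fix e :: real assume e: "e > 0"
  then obtain d where d: "d > 0" "\<And>A. A \<in> sets circle_measure \<Longrightarrow>
      emeasure circle_measure A < ennreal d \<Longrightarrow> \<rho> (indicator A) < ennreal e"
    using small_sets by blast
  obtain K where K: "compact K" "K \<subseteq> A" "measure circle_measure A < measure circle_measure K + d / 2"
    using circle_inner_compact[OF A, of "d / 2"] d(1) by auto
  obtain K' where K': "compact K'" "K' \<subseteq> space circle_measure - A"
    "measure circle_measure (space circle_measure - A) < measure circle_measure K' + d / 2"
    using circle_inner_compact[of "space circle_measure - A" "d / 2"] sets.compl_sets[OF A] d(1)
    by (metis half_gt_zero)
  have As: "A \<subseteq> sphere 0 1" using sets.sets_into_space[OF A] by simp
  have comp: "X \<in> sets circle_measure" if "compact X" "X \<subseteq> sphere 0 1" for X :: "complex set"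
    unfolding circle_measure_def using that
    by (intro sets_completionI_sets) (auto simp: sets_restrict_space intro!: image_eqI[of _ _ X] borel_compact)
  have KK[measurable]: "K \<in> sets circle_measure" "K' \<in> sets circle_measure"
    using K K' As by (auto intro!: comp)
  obtain g :: "complex \<Rightarrow> real" where g: "continuous_on UNIV g" "\<And>x. g x \<in> closed_segment 1 0"
    "\<And>x. x \<in> K \<Longrightarrow> g x = 1" "\<And>x. x \<in> K' \<Longrightarrow> g x = 0"
    by (rule Urysohn[of K K' 1 0]) (use K K' in \<open>auto intro: compact_imp_closed\<close>)
  have g01: "0 \<le> g x" "g x \<le> 1" for x using g(2)[of x] by (auto simp: closed_segment_eq_real_ivl)
  define D where "D = space circle_measure - (K \<union> K')"
  have [measurable]: "D \<in> sets circle_measure" unfolding D_def by measurable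
  have "measure circle_measure (K \<union> K') = measure circle_measure K + measure circle_measure K'"
    using K(2) K'(2) by (intro finite_measure_Union) auto
  then have "measure circle_measure D < d"
    using prob_compl[of "K \<union> K'"] prob_compl[OF A] K(3) K'(3) KK by (simp add: D_def)
  then have D: "\<rho> (indicator D) < ennreal e"
    by (intro d(2)) (auto simp: emeasure_eq_measure ennreal_less_iff)
  have [measurable]: "g \<in> borel_measurable circle_measure"
    using g(1) by (intro borel_measurable_circle borel_measurable_continuous_onI)
  have "bfs_norm \<rho> (\<lambda>t. indicator A t - of_real (g t)) \<le> bfs_norm \<rho> (indicator D)"
  proof (rule bfs_norm_mono)
    fix t :: complex assume t: "norm t = 1"
    have "\<bar>indicator A t - g t\<bar> \<le> indicator D t"
      using g01[of t] g(3,4)[of t] K(2) K'(2) t by (auto simp: D_def indicator_def)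
    moreover have "indicator A t - complex_of_real (g t) = complex_of_real (indicator A t - g t)"
      by (simp add: indicator_def)
    moreover have "norm (indicator D t :: complex) = indicator D t" by (simp add: indicator_def)
    ultimately show "norm (indicator A t - complex_of_real (g t)) \<le> norm (indicator D t :: complex)"
      by (simp only: norm_of_real)
  qed measurable
  also have "bfs_norm \<rho> (indicator D) = \<rho> (indicator D)"
    unfolding bfs_norm_def by (rule arg_cong[where f = \<rho>]) (auto simp: indicator_def)
  finally have "bfs_norm \<rho> (\<lambda>t. indicator A t - of_real (g t)) < ennreal e" using D by simp
  then show "\<exists>h. approximable h \<and> bfs_norm \<rho> (\<lambda>t. indicator A t - h t) < ennreal e"
    using approximable_continuous[OF g(1)] by blast
qed

lemma approximable_add:
  assumes "approximable f" "approximable g"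
  shows "approximable (\<lambda>z. f z + g z)"
  unfolding approximable_def
proof (intro conjI allI impI)
  have [measurable]: "f \<in> borel_measurable circle_measure" "g \<in> borel_measurable circle_measure"
    using assms by (auto simp: approximable_def)
  show "(\<lambda>z. f z + g z) \<in> borel_measurable circle_measure" by measurable
  fix e :: real assume e: "e > 0"
  then have "e / 2 > 0" by simp
  then obtain p q p' q' where p: "trig_poly p q" "bfs_norm \<rho> (\<lambda>t. f t - p t) < ennreal (e / 2)"
    and p': "trig_poly p' q'" "bfs_norm \<rho> (\<lambda>t. g t - p' t) < ennreal (e / 2)"
    using assms unfolding approximable_def by blast
  note [measurable] = trig_poly_measurable_circle[OF p(1)] trig_poly_measurable_circle[OF p'(1)]
  have "bfs_norm \<rho> (\<lambda>t. f t + g t - (p t + p' t)) = bfs_norm \<rho> (\<lambda>t. (f t - p t) + (g t - p' t))"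
    by (simp add: algebra_simps)
  also have "\<dots> \<le> bfs_norm \<rho> (\<lambda>t. f t - p t) + bfs_norm \<rho> (\<lambda>t. g t - p' t)"
    by (rule bfs_norm_add) measurable
  also have "\<dots> < ennreal e" using p(2) p'(2) e by (intro ennreal_add_less_half) auto
  finally show "\<exists>p q. trig_poly p q \<and> bfs_norm \<rho> (\<lambda>t. f t + g t - p t) < ennreal e"
    using trig_poly.add[OF p(1) p'(1)] by blast
qed

lemma approximable_cmult:
  assumes "approximable f"
  shows "approximable (\<lambda>z. c * f z)"
proof -
  have [measurable]: "f \<in> borel_measurable circle_measure"
    using assms by (auto simp: approximable_def)
  show ?thesis
  proof (rule approximable_limit)
    fix e :: real assume e: "e > 0"
    define d where "d = e / (norm c + 1)"
    have c1: "norm c + 1 > 0" by (simp add: add_nonneg_pos)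
    have d: "d > 0" unfolding d_def using e c1 by (rule divide_pos_pos)
    have "norm c * d < (norm c + 1) * d" using d by (simp add: distrib_right)
    also have "\<dots> = e" using c1 by (simp add: d_def)
    finally have d': "norm c * d < e" .
    obtain p q where p: "trig_poly p q" "bfs_norm \<rho> (\<lambda>t. f t - p t) < ennreal d"
      using assms d unfolding approximable_def by blast
    note [measurable] = trig_poly_measurable_circle[OF p(1)]
    have "trig_on_circle (\<lambda>z. c * p z)"
      using trig_on_circle_mult[OF trig_on_circle_const[of c] trig_on_circleI[OF p(1), of p]] by simp
    then have "approximable (\<lambda>z. c * p z)" by (rule approximable_trig_on_circle) measurable
    moreover have "bfs_norm \<rho> (\<lambda>t. c * f t - c * p t) \<le> ennreal (norm c) * bfs_norm \<rho> (\<lambda>t. f t - p t)"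
      by (rule bfs_norm_le_cmult) (auto simp: norm_mult simp flip: right_diff_distrib)
    moreover have "ennreal (norm c) * bfs_norm \<rho> (\<lambda>t. f t - p t) \<le> ennreal (norm c) * ennreal d"
      using p(2) by (intro mult_left_mono) auto
    moreover have "ennreal (norm c) * ennreal d < ennreal e"
      using d d' e by (simp add: ennreal_less_iff flip: ennreal_mult)
    ultimately show "\<exists>g. approximable g \<and> bfs_norm \<rho> (\<lambda>t. c * f t - g t) < ennreal e"
      by (meson le_less_trans order_trans)
  qed measurable
qed

lemma approximable_bounded:
  assumes f: "f \<in> borel_measurable circle_measure" and bd: "\<And>t. norm t = 1 \<Longrightarrow> norm (f t) \<le> K"
  shows "approximable f"
proof (rule approximable_limit[OF f])
  fix e :: real assume e: "e > 0"
  define d where "d = e / (norm_one + 1)"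
  have d: "d > 0" "d * norm_one < e" using e norm_one(1) by (auto simp: d_def field_simps)
  obtain s where s: "simple_function circle_measure s" "\<And>t. norm t = 1 \<Longrightarrow> norm (f t - s t) \<le> d"
    using bounded_simple_approx[OF f bd d(1)] by blast
  note [measurable] = f borel_measurable_simple_function[OF s(1)]
  define h where "h = (\<lambda>t. \<Sum>y\<in>s ` space circle_measure. y * indicator (s -` {y} \<inter> space circle_measure) t)"
  have fin: "finite (s ` space circle_measure)" using s(1) by (rule simple_functionD)
  have sets: "s -` {y} \<inter> space circle_measure \<in> sets circle_measure" for y
    using s(1) by (rule simple_functionD)
  have "approximable (\<lambda>t. \<Sum>y\<in>Y. y * indicator (s -` {y} \<inter> space circle_measure) t)" if "finite Y" for Y
    using that
  proof induction
    case empty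
    show ?case using approximable_trig_on_circle[OF trig_on_circle_const[of 0]] by simp
  next
    case (insert y Y)
    have "(\<lambda>t. \<Sum>y\<in>insert y Y. y * indicator (s -` {y} \<inter> space circle_measure) t) =
        (\<lambda>t. y * indicator (s -` {y} \<inter> space circle_measure) t +
          (\<Sum>y\<in>Y. y * indicator (s -` {y} \<inter> space circle_measure) t))"
      using insert.hyps by (subst sum.insert) auto
    then show ?case
      using insert.IH by (simp only:) (intro approximable_add approximable_cmult approximable_indicator sets)
  qed
  then have h: "approximable h" unfolding h_def using fin by blast
  then have [measurable]: "h \<in> borel_measurable circle_measure" by (simp add: approximable_def)
  have hs: "h t = s t" if "norm t = 1" for t
  proof -
    have "h t = (\<Sum>y\<in>{s t}. y * indicator (s -` {y} \<inter> space circle_measure) t)"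
      unfolding h_def using fin that
      by (intro sum.mono_neutral_right) (auto simp: indicator_def)
    then show ?thesis using that by simp
  qed
  have "bfs_norm \<rho> (\<lambda>t. f t - h t) \<le> ennreal (d * norm_one)"
    using d s(2) by (intro bfs_norm_bounded) (auto simp: hs)
  also have "\<dots> < ennreal e" using d e norm_one(1) by (simp add: ennreal_less_iff)
  finally show "\<exists>g. approximable g \<and> bfs_norm \<rho> (\<lambda>t. f t - g t) < ennreal e" using h by blast
qed

end

section \<open>Boundedness of the Riesz projection\<close>

text \<open>Sets and polynomials vary with \<open>n\<close>, but the bounds 3 and \<open>m\<close>
  do not, so estimates obtained from them survive the passage to the union. The height
  \<open>m\<close> is arbitrary and affects only \<open>d\<close>; bounds of order
  \<open>1 / m\<close> thus become small with the measure.\<close>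

lemma trig_poly_large_projection_cover:
  assumes m: "m > 0"
  obtains d where "d > 0" "\<And>A. A \<in> sets circle_measure \<Longrightarrow> emeasure circle_measure A < ennreal d \<Longrightarrow>
    \<exists>V p q. (\<forall>n::nat. V n \<in> sets circle_measure) \<and> incseq V \<and> A \<subseteq> (\<Union>n. V n) \<and>
      (\<forall>n. trig_poly (p n) (q n) \<and> (\<forall>z. norm z = 1 \<longrightarrow> norm (p n z) \<le> 3) \<and> (\<forall>z\<in>V n. m \<le> norm (q n z)))"
proof -
  \<comment> \<open>Chosen so that the lower bound
    \<open>(ln (1 + 1 / (4 * \<epsilon>)) - ln 2 - 1) / 2\<close> for the projection equals
    \<open>m\<close>.\<close>
  define \<epsilon> where "\<epsilon> = 1 / (4 * (exp (2 * m + ln 2 + 1) - 1))"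
  have e1: "exp (2 * m + ln 2 + 1) > 1" using m by (auto simp: add_pos_pos)
  then have \<epsilon>: "\<epsilon> > 0" by (simp add: \<epsilon>_def)
  have "1 / (4 * \<epsilon>) = exp (2 * m + ln 2 + 1) - 1" using e1 by (simp add: \<epsilon>_def)
  then have m_eq: "(ln (1 + 1 / (4 * \<epsilon>)) - ln 2 - 1) / 2 = m" by simp
  show ?thesis
  proof (rule that[of "\<epsilon> / (2 * pi)"])
    show "\<epsilon> / (2 * pi) > 0" using \<epsilon> by simp
    fix A assume "A \<in> sets circle_measure" "emeasure circle_measure A < ennreal (\<epsilon> / (2 * pi))"
    then obtain V :: "nat \<Rightarrow> complex set" and J :: "nat \<Rightarrow> nat set" and L :: "nat \<Rightarrow> real" where V:
      "\<And>n. V n \<in> sets circle_measure" "incseq V" "A \<subseteq> (\<Union>n. V n)" "\<And>n. finite (J n)" "\<And>n. L n > 0"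
      "\<And>n. card (J n) * L n \<le> \<epsilon>"
      "\<And>n z. z \<in> V n \<Longrightarrow> norm z = 1 \<and> (\<exists>k\<in>J n. dist z (cis (real k * L n)) \<le> L n)"
      by (rule circle_arc_cover) blast
    have "\<exists>p q. trig_poly p q \<and> (\<forall>z. norm z = 1 \<longrightarrow> norm (p z) \<le> 3) \<and> (\<forall>z\<in>V n. m \<le> norm (q z))" for n
    proof -
      obtain p q where p: "trig_poly p q" "\<And>z. norm z = 1 \<Longrightarrow> norm (p z) \<le> 3"
        "\<And>z k. norm z = 1 \<Longrightarrow> k \<in> J n \<Longrightarrow> dist z (cis (real k * L n)) \<le> L n \<Longrightarrow>
         (ln (1 + 1 / (4 * \<epsilon>)) - ln 2 - 1) / 2 \<le> norm (q z)"
        by (rule trig_poly_bounded_with_large_projection[of "J n" "\<lambda>k. cis (real k * L n)" "L n" \<epsilon>])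
           (use V(4-6) \<epsilon> in auto)
      have "m \<le> norm (q z)" if "z \<in> V n" for z using V(7)[OF that] p(3)[of z] unfolding m_eq by blast
      then show ?thesis using p(1,2) by blast
    qed
    then obtain p q where "\<And>n. trig_poly (p n) (q n) \<and> (\<forall>z. norm z = 1 \<longrightarrow> norm (p n z) \<le> 3) \<and>
      (\<forall>z\<in>V n. m \<le> norm (q n z))" by metis
    then show "\<exists>V p q. (\<forall>n::nat. V n \<in> sets circle_measure) \<and> incseq V \<and> A \<subseteq> (\<Union>n. V n) \<and>
      (\<forall>n. trig_poly (p n) (q n) \<and> (\<forall>z. norm z = 1 \<longrightarrow> norm (p n z) \<le> 3) \<and> (\<forall>z\<in>V n. m \<le> norm (q n z)))"
      using V(1-3) by (intro exI[of _ V] exI[of _ p] exI[of _ q]) auto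
  qed
qed

section \<open>The transpose of the Riesz projection\<close>

lemma integrable_circle_bounded:
  fixes f :: "complex \<Rightarrow> complex"
  assumes "f \<in> borel_measurable circle_measure" "\<And>t. norm t = 1 \<Longrightarrow> norm (f t) \<le> B"
  shows "integrable circle_measure f"
proof -
  interpret prob_space circle_measure by (rule prob_space_circle_measure)
  show ?thesis by (rule integrable_const_bound[where B = B]) (use assms in auto)
qed

lemma integrable_trig_poly_mult:
  assumes "trig_poly p q" "trig_poly p' q'"
  shows "integrable circle_measure (\<lambda>z. p z * p' z)" "integrable circle_measure (\<lambda>z. p z * q' z)"
    "integrable circle_measure (\<lambda>z. q z * p' z)"
    "integrable circle_measure p" "integrable circle_measure q"
proof -
  obtain B where B: "B > 0" "\<And>z. norm z = 1 \<Longrightarrow> norm (p z) \<le> B" "\<And>z. norm z = 1 \<Longrightarrow> norm (q z) \<le> B"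
    by (rule trig_poly_bounded[OF assms(1)]) blast
  obtain B' where B': "B' > 0" "\<And>z. norm z = 1 \<Longrightarrow> norm (p' z) \<le> B'" "\<And>z. norm z = 1 \<Longrightarrow> norm (q' z) \<le> B'"
    by (rule trig_poly_bounded[OF assms(2)]) blast
  note [measurable] = trig_poly_measurable_circle[OF assms(1)] trig_poly_measurable_circle[OF assms(2)]
  show "integrable circle_measure (\<lambda>z. p z * p' z)" "integrable circle_measure (\<lambda>z. p z * q' z)"
    "integrable circle_measure (\<lambda>z. q z * p' z)"
    by (rule integrable_circle_bounded[where B = "B * B'"];
        use B B' less_imp_le[OF B(1)] less_imp_le[OF B'(1)] in \<open>auto simp: norm_mult intro!: mult_mono\<close>)+
  show "integrable circle_measure p" "integrable circle_measure q"
    by (rule integrable_circle_bounded[where B = B]; use B in auto)+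
qed

text \<open>For monomials with exponents \<open>k\<close> and \<open>k'\<close> both sides vanish
  unless \<open>k + k' = 0\<close>. The left side then requires \<open>k' \<ge> 0\<close>, that is
  \<open>k \<le> 0\<close>. On the right \<open>p - pa\<close> retains the exponents
  \<open>k < 0\<close>, and the mean of \<open>p\<close> restores \<open>k = 0\<close>. Bilinearity
  does the rest.\<close>

lemma integral_mult_analytic_part:
  assumes p: "trig_poly p pa" and v: "trig_poly v va"
  shows "(LINT z|circle_measure. p z * va z) =
    (LINT z|circle_measure. (p z - pa z + integral\<^sup>L circle_measure p) * v z)"
proof -
  have expand: "(LINT z|circle_measure. (p z - pa z + integral\<^sup>L circle_measure p) * v z) =
      (LINT z|circle_measure. p z * v z) - (LINT z|circle_measure. pa z * v z) +
      integral\<^sup>L circle_measure p * integral\<^sup>L circle_measure v"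
    if "trig_poly p pa" "trig_poly v va" for p pa v va
    using integrable_trig_poly_mult[OF that] integrable_trig_poly_mult(4)[OF that(2) that(1)]
    by (simp add: distrib_right left_diff_distrib)
  have "(LINT z|circle_measure. p z * va z) =
      (LINT z|circle_measure. p z * v z) - (LINT z|circle_measure. pa z * v z) +
      integral\<^sup>L circle_measure p * integral\<^sup>L circle_measure v"
    using p
  proof induction
    case (monom c k)
    from v show ?case
    proof induction
      case (monom c' k')
      have mult: "(LINT z|circle_measure. (c * z powi k) * (c' * z powi k')) = (if k + k' = 0 then c * c' else 0)"
      proof -
        have "(LINT z|circle_measure. (c * z powi k) * (c' * z powi k')) =
            (LINT z|circle_measure. (c * c') * z powi (k + k'))"
        proof (rule Bochner_Integration.integral_cong[OF refl])
          fix z assume "z \<in> space circle_measure"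
          then have "z \<noteq> 0" by auto
          then show "(c * z powi k) * (c' * z powi k') = (c * c') * z powi (k + k')" by (simp add: power_int_add)
        qed
        then show ?thesis by (simp add: integral_power_int_circle)
      qed
      show ?case
        using mult by (cases "k \<ge> 0"; cases "k' \<ge> 0") (auto simp: integral_power_int_circle)
    next
      case (add v q v' q')
      then show ?case
        using integrable_trig_poly_mult[OF trig_poly.monom[of c k] add.hyps(1)]
          integrable_trig_poly_mult[OF trig_poly.monom[of c k] add.hyps(2)]
          integrable_trig_poly_mult[OF add.hyps(1) add.hyps(2)] integrable_trig_poly_mult[OF add.hyps(2) add.hyps(1)]
        by (simp only: distrib_left Bochner_Integration.integral_add) (simp add: algebra_simps)
    qed
  next
    case (add p q p' q')
    then show ?case
      using integrable_trig_poly_mult[OF add.hyps(1) v] integrable_trig_poly_mult[OF add.hyps(2) v]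
      by (simp only: distrib_right Bochner_Integration.integral_add) (simp add: algebra_simps)
  qed
  then show ?thesis using expand[OF p v] by simp
qed

text \<open>\<open>C\<close> bounds the projection on \<open>X\<close>, and \<open>c\<close> bounds
  the inclusion of \<open>X\<close> into \<open>L^1\<close>, which is (A5) for the whole
  circle.\<close>

locale riesz_bounded_norm =
  fixes \<rho> :: "(complex \<Rightarrow> ennreal) \<Rightarrow> ennreal" and C c :: real
  assumes bfn: "banach_function_norm \<rho>"
    and riesz: "\<And>f. f \<in> bfs \<rho> \<Longrightarrow> riesz_projection f \<in> bfs \<rho>"
      "\<And>f. f \<in> bfs \<rho> \<Longrightarrow> bfs_norm \<rho> (riesz_projection f) \<le> ennreal C * bfs_norm \<rho> f"
    and C: "C \<ge> 0" and c: "c > 0"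
    and nn_integral_le: "\<And>f. f \<in> borel_measurable circle_measure \<Longrightarrow>
      (\<integral>\<^sup>+t. f t \<partial>circle_measure) \<le> ennreal c * \<rho> f"
begin

sublocale circle_lattice_norm \<rho>
proof
  show mono: "\<rho> g \<le> \<rho> f" if "f \<in> borel_measurable circle_measure" "g \<in> borel_measurable circle_measure"
    "AE t in circle_measure. g t \<le> f t" for f g
    using bfn that unfolding banach_function_norm_def by blast
  show "\<rho> (\<lambda>t. ennreal c * f t) = ennreal c * \<rho> f" if "f \<in> borel_measurable circle_measure" "c \<ge> 0" for f c
    using bfn that unfolding banach_function_norm_def by blast
  show "\<rho> (\<lambda>t. f t + g t) \<le> \<rho> f + \<rho> g"
    if "f \<in> borel_measurable circle_measure" "g \<in> borel_measurable circle_measure" for f g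
    using bfn that unfolding banach_function_norm_def by blast
  have "\<rho> (\<lambda>_. 1) \<le> \<rho> (indicator (space circle_measure))"
    by (intro mono borel_measurable_indicator sets.top AE_I2) auto
  also have "\<dots> < \<infinity>"
    using bfn sets.top unfolding banach_function_norm_def by blast
  finally show "\<rho> (\<lambda>_. 1) < \<infinity>" .
qed

text \<open>The boundedness of \<open>P\<close> is used through this inequality alone. It applies
  because \<open>p\<close> is bounded on the circle, hence lies in \<open>X\<close>, and its
  projection equals \<open>q\<close> there.\<close>

lemma bfs_norm_analytic_part_le:
  assumes "trig_poly p q"
  shows "bfs_norm \<rho> q \<le> ennreal C * bfs_norm \<rho> p"
proof -
  note [measurable] = trig_poly_measurable_circle[OF assms]
  obtain B where B: "\<And>z. norm z = 1 \<Longrightarrow> norm (p z) \<le> B"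
    by (rule trig_poly_bounded[OF assms]) blast
  have p: "p \<in> bfs \<rho>" using B by (rule bounded_in_bfs[rotated]) measurable
  have "bfs_norm \<rho> q \<le> bfs_norm \<rho> (riesz_projection p)"
    using riesz(1)[OF p]
    by (intro bfs_norm_mono) (auto simp: bfs_def riesz_projection_trig_poly[OF assms])
  also have "\<dots> \<le> ennreal C * bfs_norm \<rho> p" by (rule riesz(2)[OF p])
  finally show ?thesis .
qed

text \<open>On \<open>V n\<close> the modulus of \<open>q n\<close> is at least \<open>m\<close>,
  while the norm of \<open>q n\<close> is at most \<open>K\<close> for every \<open>n\<close>; so
  the indicator of \<open>V n\<close> has norm at most \<open>K / m\<close>. The Fatou property (A3)
  carries this bound over to the union, which contains \<open>A\<close>.\<close>

sublocale abs_cont_circle_norm \<rho>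
proof
  fix e :: real assume e: "e > 0"
  define K where "K = C * (3 * norm_one)"
  have K: "K \<ge> 0" using C norm_one(1) by (simp add: K_def)
  \<comment> \<open>Any \<open>m\<close> with \<open>K / m < e\<close> would do; the summand 1 keeps
    \<open>m\<close> positive when \<open>K = 0\<close>.\<close>
  define m where "m = (K + 1) / e"
  have m: "m > 0" "K / m < e" using e K by (auto simp: m_def field_simps)
  obtain d where d: "d > 0" "\<And>A. A \<in> sets circle_measure \<Longrightarrow> emeasure circle_measure A < ennreal d \<Longrightarrow>
    \<exists>V p q. (\<forall>n::nat. V n \<in> sets circle_measure) \<and> incseq V \<and> A \<subseteq> (\<Union>n. V n) \<and>
      (\<forall>n. trig_poly (p n) (q n) \<and> (\<forall>z. norm z = 1 \<longrightarrow> norm (p n z) \<le> 3) \<and> (\<forall>z\<in>V n. m \<le> norm (q n z)))"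
    by (rule trig_poly_large_projection_cover[OF m(1)]) blast
  show "\<exists>d>0. \<forall>A\<in>sets circle_measure. emeasure circle_measure A < ennreal d \<longrightarrow> \<rho> (indicator A) < ennreal e"
  proof (intro exI conjI ballI impI, rule d(1))
    fix A assume A[measurable]: "A \<in> sets circle_measure" and "emeasure circle_measure A < ennreal d"
    then obtain V p q where V[measurable]: "\<And>n::nat. V n \<in> sets circle_measure"
      and V': "incseq V" "A \<subseteq> (\<Union>n. V n)"
      and pq: "\<And>n. trig_poly (p n) (q n)" "\<And>n z. norm z = 1 \<Longrightarrow> norm (p n z) \<le> 3"
        "\<And>n z. z \<in> V n \<Longrightarrow> m \<le> norm (q n z)"
      using d(2)[of A] by blast
    have "\<rho> (indicator (V n)) \<le> ennreal (K / m)" for n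
    proof -
      note [measurable] = trig_poly_measurable_circle[OF pq(1), of n]
      have "\<rho> (indicator (V n)) = bfs_norm \<rho> (indicator (V n))"
        unfolding bfs_norm_def by (rule arg_cong[where f = \<rho>]) (auto simp: indicator_def)
      also have "\<dots> \<le> ennreal (1 / m) * bfs_norm \<rho> (q n)"
        using m(1) pq(3)[of _ n] by (intro bfs_norm_le_cmult) (auto simp: indicator_def)
      also have "\<dots> \<le> ennreal (1 / m) * (ennreal C * ennreal (3 * norm_one))"
        by (intro mult_left_mono order_trans[OF bfs_norm_analytic_part_le[OF pq(1)]] bfs_norm_bounded pq(2)) auto
      also have "\<dots> = ennreal (K / m)"
        using m(1) C norm_one(1) by (simp add: K_def flip: ennreal_mult)
      finally show ?thesis .
    qed
    moreover have "(\<lambda>n. \<rho> (indicator (V n))) \<longlonglongrightarrow> \<rho> (indicator (\<Union>n. V n))"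
    proof -
      have "AE t in circle_measure. incseq (\<lambda>n. indicator (V n) t :: ennreal) \<and>
          (\<lambda>n. indicator (V n) t :: ennreal) \<longlonglongrightarrow> indicator (\<Union>n. V n) t"
        by (intro AE_I2 conjI LIMSEQ_indicator_incseq V'(1))
           (use V'(1) in \<open>auto simp: incseq_def indicator_def\<close>)
      then show ?thesis
        using bfn unfolding banach_function_norm_def by (elim conjE) (auto simp: V)
    qed
    ultimately have "\<rho> (indicator (\<Union>n. V n)) \<le> ennreal (K / m)"
      by (intro LIMSEQ_le_const2) auto
    moreover have "\<rho> (indicator A) \<le> \<rho> (indicator (\<Union>n. V n))"
      using V'(2) by (intro mono AE_I2) (auto simp: indicator_def)
    moreover have "ennreal (K / m) < ennreal e" using m e K by (simp add: ennreal_less_iff)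
    ultimately show "\<rho> (indicator A) < ennreal e" by (meson le_less_trans)
  qed
qed

section \<open>Set integrals and the associate norm\<close>

lemma integral_norm_le:
  fixes g :: "complex \<Rightarrow> complex"
  assumes [measurable]: "g \<in> borel_measurable circle_measure" and "bfs_norm \<rho> g \<le> ennreal b" "b \<ge> 0"
  shows "integrable circle_measure g" "(LINT t|circle_measure. norm (g t)) \<le> c * b"
proof -
  have le: "(\<integral>\<^sup>+t. ennreal (norm (g t)) \<partial>circle_measure) \<le> ennreal (c * b)"
  proof -
    have "(\<integral>\<^sup>+t. ennreal (norm (g t)) \<partial>circle_measure) \<le> ennreal c * bfs_norm \<rho> g"
      unfolding bfs_norm_def by (rule nn_integral_le) measurable
    also have "\<dots> \<le> ennreal c * ennreal b" using assms(2) by (rule mult_left_mono) simp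
    also have "\<dots> = ennreal (c * b)" using c assms(3) by (simp add: ennreal_mult)
    finally show ?thesis .
  qed
  show int: "integrable circle_measure g"
    using le by (intro integrableI_bounded) (auto intro: le_less_trans)
  show "(LINT t|circle_measure. norm (g t)) \<le> c * b"
    using le c assms(3)
    by (subst (asm) nn_integral_eq_integral) (use int in \<open>auto simp: ennreal_le_iff\<close>)
qed

lemma integral_mult_le:
  fixes g h :: "complex \<Rightarrow> complex"
  assumes [measurable]: "g \<in> borel_measurable circle_measure" "h \<in> borel_measurable circle_measure"
    and g: "bfs_norm \<rho> g \<le> ennreal b" "b \<ge> 0" and h: "\<And>t. norm t = 1 \<Longrightarrow> norm (h t) \<le> B" "B \<ge> 0"
  shows "integrable circle_measure (\<lambda>t. g t * h t)"
    "norm (LINT t|circle_measure. g t * h t) \<le> B * (c * b)"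
proof -
  note g' = integral_norm_le[OF assms(1) g]
  show int: "integrable circle_measure (\<lambda>t. g t * h t)"
    by (rule Bochner_Integration.integrable_bound[OF integrable_mult_right[of B _ "\<lambda>t. norm (g t)"]])
       (use g' h in \<open>auto simp: norm_mult mult.commute[of B] intro!: AE_I2 mult_left_mono\<close>)
  have "norm (LINT t|circle_measure. g t * h t) \<le> (LINT t|circle_measure. norm (g t * h t))"
    by (rule integral_norm_bound)
  also have "\<dots> \<le> (LINT t|circle_measure. B * norm (g t))"
    by (rule integral_mono)
       (use integrable_norm[OF int] g' h in \<open>auto simp: norm_mult mult.commute[of B] intro!: mult_left_mono integrable_norm\<close>)
  also have "\<dots> \<le> B * (c * b)" using g'(2) h(2) by (simp add: mult_left_mono)
  finally show "norm (LINT t|circle_measure. g t * h t) \<le> B * (c * b)" .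
qed

text \<open>The map \<open>p \<mapsto> p - P p + \<integral> p\<close> is the transpose of \<open>P\<close>; its boundedness on the space replaces
  boundedness of \<open>P\<close> on the associate space.\<close>

lemma integral_mult_analytic_part_le:
  assumes p: "trig_poly p pa" and v: "trig_poly v va" "\<And>z. norm z = 1 \<Longrightarrow> norm (v z) \<le> 3"
    and b: "bfs_norm \<rho> p \<le> ennreal b" "b \<ge> 0"
  shows "norm (LINT z|circle_measure. p z * va z) \<le> 3 * (c * ((1 + C + c * norm_one) * b))"
proof -
  note [measurable] = trig_poly_measurable_circle[OF p] trig_poly_measurable_circle[OF v(1)]
  define a where "a = integral\<^sup>L circle_measure p"
  have "norm a \<le> (LINT t|circle_measure. norm (p t))" unfolding a_def by (rule integral_norm_bound)
  also have "\<dots> \<le> c * b" by (rule integral_norm_le[OF _ b]) measurable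
  finally have a: "norm a \<le> c * b" .
  \<comment> \<open>The three summands of the factor \<open>1 + C + c * norm_one\<close> belong to
    \<open>p\<close>, to its projection \<open>pa\<close> and to the constant function
    \<open>a\<close>, whose modulus is at most \<open>c * b\<close>.\<close>
  have "bfs_norm \<rho> (\<lambda>z. p z - pa z + a) \<le> bfs_norm \<rho> (\<lambda>z. p z + (- pa z)) + bfs_norm \<rho> (\<lambda>z. a)"
    using bfs_norm_add[of "\<lambda>z. p z - pa z" "\<lambda>z. a"] by simp
  also have "bfs_norm \<rho> (\<lambda>z. p z + (- pa z)) \<le> bfs_norm \<rho> p + bfs_norm \<rho> (\<lambda>z. - pa z)"
    by (rule bfs_norm_add) measurable
  also have "bfs_norm \<rho> (\<lambda>z. - pa z) = bfs_norm \<rho> pa" by (simp add: bfs_norm_def)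
  also have "bfs_norm \<rho> p + bfs_norm \<rho> pa + bfs_norm \<rho> (\<lambda>z. a) \<le>
      ennreal b + ennreal C * ennreal b + ennreal (c * b * norm_one)"
    using a b c
    by (intro add_mono b(1) bfs_norm_bounded order_trans[OF bfs_norm_analytic_part_le[OF p]] mult_left_mono) auto
  also have "\<dots> = ennreal ((1 + C + c * norm_one) * b)"
    using b(2) c C norm_one(1) by (simp add: algebra_simps flip: ennreal_mult ennreal_plus)
  finally have le: "bfs_norm \<rho> (\<lambda>z. p z - pa z + a) \<le> ennreal ((1 + C + c * norm_one) * b)"
    by (simp add: add_right_mono)
  show ?thesis
    unfolding integral_mult_analytic_part[OF p v(1)] a_def[symmetric]
    using le v(2) b(2) c C norm_one(1) by (intro integral_mult_le) auto
qed

text \<open>The integral is that of \<open>\<phi> * w\<close>, where \<phi> has norm at most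
  \<open>1 / m\<close>. Boundedness of \<open>f\<close> serves to make \<phi> approximable by
  trigonometric polynomials, for which the transposed estimate is available; the bound
  \<open>K\<close> itself drops out of the conclusion, which permits a later passage to unbounded
  \<open>f\<close>.\<close>

lemma integral_bounded_le:
  fixes f :: "complex \<Rightarrow> real"
  assumes f[measurable]: "f \<in> borel_measurable circle_measure" and f0: "\<And>t. 0 \<le> f t" "\<And>t. f t \<le> K"
    and f1: "\<rho> (\<lambda>t. ennreal (f t)) \<le> 1"
    and V[measurable]: "V \<in> sets circle_measure" and m: "m > 0"
    and v: "trig_poly v w" "\<And>z. norm z = 1 \<Longrightarrow> norm (v z) \<le> 3" "\<And>z. z \<in> V \<Longrightarrow> m \<le> norm (w z)"
  shows "(LINT t|circle_measure. f t * indicator V t) \<le> 3 * (c * (1 + C + c * norm_one)) / m"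
proof -
  note [measurable] = trig_poly_measurable_circle[OF v(1)]
  obtain B where B: "B > 0" "\<And>z. norm z = 1 \<Longrightarrow> norm (w z) \<le> B"
    by (rule trig_poly_bounded[OF v(1)]) blast
  \<comment> \<open>Off \<open>V\<close> the numerator is 0, so \<phi> is 0 there even at zeros of
    \<open>w\<close>; on \<open>V\<close> the denominator has modulus at least
    \<open>m\<close>.\<close>
  define \<phi> where "\<phi> = (\<lambda>t. of_real (f t * indicator V t) / w t)"
  have [measurable]: "\<phi> \<in> borel_measurable circle_measure" unfolding \<phi>_def by measurable
  have \<phi>_le: "norm (\<phi> t) \<le> 1 / m * norm (complex_of_real (f t))" for t
    using f0(1)[of t] m v(3)[of t] by (auto simp: \<phi>_def indicator_def norm_divide intro!: divide_left_mono mult_pos_pos)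
  have \<phi>_norm: "bfs_norm \<rho> \<phi> \<le> ennreal (1 / m)"
  proof -
    have "bfs_norm \<rho> \<phi> \<le> ennreal (1 / m) * bfs_norm \<rho> (\<lambda>t. complex_of_real (f t))"
      using m by (intro bfs_norm_le_cmult \<phi>_le) auto
    also have "bfs_norm \<rho> (\<lambda>t. complex_of_real (f t)) \<le> 1" using f1 f0(1) by (simp add: bfs_norm_def)
    finally show ?thesis by (simp add: mult_left_mono)
  qed
  have "approximable \<phi>"
  proof (rule approximable_bounded[where K = "1 / m * K"])
    fix t :: complex
    have "1 / m * norm (complex_of_real (f t)) \<le> 1 / m * K"
      using f0[of t] m by (intro mult_left_mono) auto
    then show "norm (\<phi> t) \<le> 1 / m * K" using \<phi>_le[of t] by linarith
  qed measurable
  \<comment> \<open>The bound \<open>B\<close> depends on \<open>w\<close> and is not controlled,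
    but it multiplies only the approximation error, so it disappears as \<delta> tends to 0.\<close>
  have step: "(LINT t|circle_measure. f t * indicator V t) \<le>
      3 * (c * (1 + C + c * norm_one)) / m + (B * c + 3 * (c * (1 + C + c * norm_one))) * \<delta>" if \<delta>: "\<delta> > 0" for \<delta>
  proof -
    obtain p q where p: "trig_poly p q" "bfs_norm \<rho> (\<lambda>t. \<phi> t - p t) < ennreal \<delta>"
      using \<open>approximable \<phi>\<close> \<delta> unfolding approximable_def by blast
    note [measurable] = trig_poly_measurable_circle[OF p(1)]
    have "bfs_norm \<rho> (\<lambda>t. p t - \<phi> t) = bfs_norm \<rho> (\<lambda>t. \<phi> t - p t)"
      by (simp add: bfs_norm_def norm_minus_commute)
    then have "bfs_norm \<rho> p \<le> ennreal (1 / m) + ennreal \<delta>"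
      using bfs_norm_add[of \<phi> "\<lambda>t. p t - \<phi> t"] \<phi>_norm p(2) by (simp add: add_mono order_trans less_imp_le)
    then have pn: "bfs_norm \<rho> p \<le> ennreal (1 / m + \<delta>)" using m \<delta> by simp
    have err: "integrable circle_measure (\<lambda>t. (\<phi> t - p t) * w t)"
      "norm (LINT t|circle_measure. (\<phi> t - p t) * w t) \<le> B * (c * \<delta>)"
      using p(2) \<delta> B by (auto intro!: integral_mult_le less_imp_le[OF p(2)])
    have main: "norm (LINT z|circle_measure. p z * w z) \<le> 3 * (c * ((1 + C + c * norm_one) * (1 / m + \<delta>)))"
      using pn m \<delta> by (intro integral_mult_analytic_part_le[OF p(1) v(1,2)]) auto
    have "complex_of_real (LINT t|circle_measure. f t * indicator V t) =
        (LINT t|circle_measure. complex_of_real (f t * indicator V t))"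
      by (rule integral_complex_of_real[symmetric])
    also have "\<dots> = (LINT t|circle_measure. (\<phi> t - p t) * w t + p t * w t)"
    proof (rule Bochner_Integration.integral_cong[OF refl])
      fix t
      have "\<phi> t * w t = complex_of_real (f t * indicator V t)"
        using m v(3)[of t] by (auto simp: \<phi>_def indicator_def)
      then show "complex_of_real (f t * indicator V t) = (\<phi> t - p t) * w t + p t * w t"
        by (simp add: algebra_simps)
    qed
    also have "\<dots> = (LINT t|circle_measure. (\<phi> t - p t) * w t) + (LINT t|circle_measure. p t * w t)"
      by (intro Bochner_Integration.integral_add err(1) integrable_trig_poly_mult(2)[OF p(1) v(1)])
    finally have "\<bar>LINT t|circle_measure. f t * indicator V t\<bar> =
        norm ((LINT t|circle_measure. (\<phi> t - p t) * w t) + (LINT t|circle_measure. p t * w t))"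
      by (metis norm_of_real)
    also have "\<dots> \<le> B * (c * \<delta>) + 3 * (c * ((1 + C + c * norm_one) * (1 / m + \<delta>)))"
      by (rule order_trans[OF norm_triangle_ineq add_mono[OF err(2) main]])
    finally show ?thesis by (simp add: algebra_simps add_divide_distrib)
  qed
  define D where "D = B * c + 3 * (c * (1 + C + c * norm_one))"
  have D: "D > 0" using B(1) c C norm_one(1) unfolding D_def by (intro add_pos_nonneg) auto
  show ?thesis
  proof (rule field_le_epsilon)
    fix e :: real assume "e > 0"
    then show "(LINT t|circle_measure. f t * indicator V t) \<le> 3 * (c * (1 + C + c * norm_one)) / m + e"
      using step[of "e / D"] D unfolding D_def[symmetric] by simp
  qed
qed

text \<open>The truncations of \<open>f\<close> at height \<open>n\<close> are bounded and have norm
  at most 1 by monotonicity, and the estimate for them does not depend on \<open>n\<close>. Monotone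
  convergence then covers unbounded \<open>f\<close>, including the value infinity.\<close>

lemma nn_integral_set_le:
  assumes f[measurable]: "f \<in> borel_measurable circle_measure" and f1: "\<rho> f \<le> 1"
    and V[measurable]: "V \<in> sets circle_measure" and m: "m > 0"
    and v: "trig_poly v w" "\<And>z. norm z = 1 \<Longrightarrow> norm (v z) \<le> 3" "\<And>z. z \<in> V \<Longrightarrow> m \<le> norm (w z)"
  shows "(\<integral>\<^sup>+t. f t * indicator V t \<partial>circle_measure) \<le> ennreal (3 * (c * (1 + C + c * norm_one)) / m)"
proof -
  interpret prob_space circle_measure by (rule prob_space_circle_measure)
  define g where "g = (\<lambda>n t. enn2real (min (f t) (of_nat n)))"
  have g: "ennreal (g n t) = min (f t) (of_nat n)" for n t
    unfolding g_def by (rule ennreal_enn2real) (auto simp: min_def of_nat_less_top less_top[symmetric] top_unique)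
  have [measurable]: "g n \<in> borel_measurable circle_measure" for n unfolding g_def by measurable
  have g0: "0 \<le> g n t" for n t by (simp add: g_def)
  have gK: "g n t \<le> real n" for n t
  proof -
    have "ennreal (g n t) \<le> ennreal (real n)" unfolding g by (simp add: ennreal_of_nat_eq_real_of_nat)
    then show ?thesis by (simp add: ennreal_le_iff)
  qed
  have gn: "\<rho> (\<lambda>t. ennreal (g n t)) \<le> 1" for n
    by (rule order_trans[OF mono f1]) (auto simp: g)
  have le: "(\<integral>\<^sup>+t. ennreal (g n t) * indicator V t \<partial>circle_measure) \<le> ennreal (3 * (c * (1 + C + c * norm_one)) / m)" for n
  proof -
    have "(\<integral>\<^sup>+t. ennreal (g n t) * indicator V t \<partial>circle_measure) =
        (\<integral>\<^sup>+t. ennreal (g n t * indicator V t) \<partial>circle_measure)"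
      by (intro nn_integral_cong) (auto simp: indicator_def)
    also have "\<dots> = ennreal (LINT t|circle_measure. g n t * indicator V t)"
      by (intro nn_integral_eq_integral integrable_const_bound[where B = "real n"])
         (use g0 gK in \<open>auto simp: indicator_def\<close>)
    also have "\<dots> \<le> ennreal (3 * (c * (1 + C + c * norm_one)) / m)"
      by (intro ennreal_leI integral_bounded_le[OF _ g0 gK gn V m v]) measurable
    finally show ?thesis .
  qed
  have "(\<integral>\<^sup>+t. f t * indicator V t \<partial>circle_measure) =
      (\<integral>\<^sup>+t. (SUP n. ennreal (g n t) * indicator V t) \<partial>circle_measure)"
  proof (intro nn_integral_cong)
    fix t
    have "(SUP n. ennreal (g n t)) = inf (f t) (SUP n. of_nat n)"
      unfolding inf_SUP by (simp add: g inf_min)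
    then have "(SUP n. ennreal (g n t)) = f t" by (simp add: ennreal_SUP_of_nat_eq_top)
    then show "f t * indicator V t = (SUP n. ennreal (g n t) * indicator V t)"
      by (simp add: SUP_mult_right_ennreal[symmetric])
  qed
  also have "\<dots> = (SUP n. \<integral>\<^sup>+t. ennreal (g n t) * indicator V t \<partial>circle_measure)"
    by (intro nn_integral_monotone_convergence_SUP)
       (auto simp: incseq_def le_fun_def g intro!: mult_right_mono min.mono of_nat_mono)
  also have "\<dots> \<le> ennreal (3 * (c * (1 + C + c * norm_one)) / m)" by (intro SUP_least le)
  finally show ?thesis .
qed

text \<open>The estimate of \<open>nn_integral_set_le\<close> is uniform over all \<open>f\<close>
  with \<open>\<rho> f \<le> 1\<close>, so it bounds the supremum that defines the associate norm of
  an indicator. Finiteness of the associate norm at 1 is (A5) for the whole circle.\<close>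

lemma abs_cont_associate_norm: "abs_cont_circle_norm (associate_norm \<rho>)"
proof
  show "associate_norm \<rho> g \<le> associate_norm \<rho> f"
    if [measurable]: "f \<in> borel_measurable circle_measure" "g \<in> borel_measurable circle_measure"
      and le: "AE t in circle_measure. g t \<le> f t" for f g
    unfolding associate_norm_def
    using le by (intro SUP_mono bexI nn_integral_mono_AE) (auto elim!: eventually_mono intro!: mult_left_mono)
  show "associate_norm \<rho> (\<lambda>t. ennreal a * f t) = ennreal a * associate_norm \<rho> f"
    if [measurable]: "f \<in> borel_measurable circle_measure" and "a \<ge> 0" for f a
    unfolding associate_norm_def SUP_mult_left_ennreal
  proof (intro SUP_cong refl)
    fix h assume "h \<in> {f \<in> borel_measurable circle_measure. \<rho> f \<le> 1}"
    then have [measurable]: "h \<in> borel_measurable circle_measure" by simp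
    have "(\<integral>\<^sup>+t. h t * (ennreal a * f t) \<partial>circle_measure) = (\<integral>\<^sup>+t. ennreal a * (h t * f t) \<partial>circle_measure)"
      by (simp add: mult.left_commute)
    also have "\<dots> = ennreal a * (\<integral>\<^sup>+t. h t * f t \<partial>circle_measure)"
      by (rule nn_integral_cmult) measurable
    finally show "(\<integral>\<^sup>+t. h t * (ennreal a * f t) \<partial>circle_measure) = ennreal a * (\<integral>\<^sup>+t. h t * f t \<partial>circle_measure)" .
  qed
  show "associate_norm \<rho> (\<lambda>t. f t + g t) \<le> associate_norm \<rho> f + associate_norm \<rho> g"
    if [measurable]: "f \<in> borel_measurable circle_measure" "g \<in> borel_measurable circle_measure" for f g
    unfolding associate_norm_def
  proof (rule SUP_least)
    fix h assume h: "h \<in> {f \<in> borel_measurable circle_measure. \<rho> f \<le> 1}"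
    then have [measurable]: "h \<in> borel_measurable circle_measure" by simp
    have "(\<integral>\<^sup>+t. h t * (f t + g t) \<partial>circle_measure) =
        (\<integral>\<^sup>+t. h t * f t \<partial>circle_measure) + (\<integral>\<^sup>+t. h t * g t \<partial>circle_measure)"
      unfolding distrib_left by (rule nn_integral_add) measurable
    also have "\<dots> \<le> (SUP h\<in>{f \<in> borel_measurable circle_measure. \<rho> f \<le> 1}. \<integral>\<^sup>+t. h t * f t \<partial>circle_measure) +
        (SUP h\<in>{f \<in> borel_measurable circle_measure. \<rho> f \<le> 1}. \<integral>\<^sup>+t. h t * g t \<partial>circle_measure)"
      using h by (intro add_mono SUP_upper)
    finally show "(\<integral>\<^sup>+t. h t * (f t + g t) \<partial>circle_measure) \<le> \<dots>" .
  qed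
  have "associate_norm \<rho> (\<lambda>_. 1) \<le> ennreal c"
    unfolding associate_norm_def
  proof (rule SUP_least)
    fix h assume h: "h \<in> {f \<in> borel_measurable circle_measure. \<rho> f \<le> 1}"
    then have "(\<integral>\<^sup>+t. h t * 1 \<partial>circle_measure) \<le> ennreal c * \<rho> h" using nn_integral_le by simp
    also have "\<dots> \<le> ennreal c * 1" using h by (intro mult_left_mono) auto
    finally show "(\<integral>\<^sup>+t. h t * 1 \<partial>circle_measure) \<le> ennreal c" by simp
  qed
  then show "associate_norm \<rho> (\<lambda>_. 1) < \<infinity>" by (auto intro: le_less_trans)
  fix e :: real assume e: "e > 0"
  define K where "K = 3 * (c * (1 + C + c * norm_one))"
  have K: "K \<ge> 0" using C c norm_one(1) by (simp add: K_def)
  define m where "m = (K + 1) / e"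
  have m: "m > 0" "K / m < e" using e K by (auto simp: m_def field_simps)
  obtain d where d: "d > 0" "\<And>A. A \<in> sets circle_measure \<Longrightarrow> emeasure circle_measure A < ennreal d \<Longrightarrow>
    \<exists>V p q. (\<forall>n::nat. V n \<in> sets circle_measure) \<and> incseq V \<and> A \<subseteq> (\<Union>n. V n) \<and>
      (\<forall>n. trig_poly (p n) (q n) \<and> (\<forall>z. norm z = 1 \<longrightarrow> norm (p n z) \<le> 3) \<and> (\<forall>z\<in>V n. m \<le> norm (q n z)))"
    by (rule trig_poly_large_projection_cover[OF m(1)]) blast
  show "\<exists>d>0. \<forall>A\<in>sets circle_measure. emeasure circle_measure A < ennreal d \<longrightarrow>
      associate_norm \<rho> (indicator A) < ennreal e"
  proof (intro exI conjI ballI impI, rule d(1))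
    fix A assume A[measurable]: "A \<in> sets circle_measure" and "emeasure circle_measure A < ennreal d"
    then obtain V p q where V[measurable]: "\<And>n::nat. V n \<in> sets circle_measure"
      and V': "incseq V" "A \<subseteq> (\<Union>n. V n)"
      and pq: "\<And>n. trig_poly (p n) (q n)" "\<And>n z. norm z = 1 \<Longrightarrow> norm (p n z) \<le> 3"
        "\<And>n z. z \<in> V n \<Longrightarrow> m \<le> norm (q n z)"
      using d(2)[of A] by blast
    have "associate_norm \<rho> (indicator A) \<le> ennreal (K / m)"
      unfolding associate_norm_def
    proof (rule SUP_least)
      fix f assume "f \<in> {f \<in> borel_measurable circle_measure. \<rho> f \<le> 1}"
      then have f[measurable]: "f \<in> borel_measurable circle_measure" and f1: "\<rho> f \<le> 1" by auto
      \<comment> \<open>Reading the integral of \<open>f\<close> as a measure makes the passage from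
        \<open>V n\<close> to the union an instance of continuity from below.\<close>
      have "(\<integral>\<^sup>+t. f t * indicator A t \<partial>circle_measure) = emeasure (density circle_measure f) A"
        by (simp add: emeasure_density)
      also have "\<dots> \<le> emeasure (density circle_measure f) (\<Union>n. V n)"
        using V'(2) by (intro emeasure_mono) auto
      also have "\<dots> = (SUP n. emeasure (density circle_measure f) (V n))"
        using V'(1) by (intro SUP_emeasure_incseq[symmetric]) auto
      also have "\<dots> \<le> ennreal (K / m)"
        unfolding K_def
        by (intro SUP_least) (simp add: emeasure_density nn_integral_set_le[OF f f1 V m(1) pq])
      finally show "(\<integral>\<^sup>+t. f t * indicator A t \<partial>circle_measure) \<le> ennreal (K / m)" .
    qed
    also have "\<dots> < ennreal e" using m e K by (simp add: ennreal_less_iff)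
    finally show "associate_norm \<rho> (indicator A) < ennreal e" .
  qed
qed

end

theorem theorem3p7:
  fixes \<rho> :: "(complex \<Rightarrow> ennreal) \<Rightarrow> ennreal"
  assumes "banach_function_norm \<rho>"
    and "bounded_on_bfs \<rho> riesz_projection"
  shows "abs_cont_part \<rho> = simple_closure \<rho> \<and>
         abs_cont_part (associate_norm \<rho>) = simple_closure (associate_norm \<rho>)"
proof -
  obtain C where C: "\<And>f. f \<in> bfs \<rho> \<Longrightarrow> bfs_norm \<rho> (riesz_projection f) \<le> ennreal C * bfs_norm \<rho> f"
    using assms(2) unfolding bounded_on_bfs_def by blast
  have "\<exists>c::real. c > 0 \<and> (\<forall>f \<in> borel_measurable circle_measure.
      (\<integral>\<^sup>+t\<in>space circle_measure. f t \<partial>circle_measure) \<le> ennreal c * \<rho> f)"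
    using assms(1) sets.top unfolding banach_function_norm_def by blast
  then obtain c :: real where c: "c > 0" "\<And>f. f \<in> borel_measurable circle_measure \<Longrightarrow>
      (\<integral>\<^sup>+t. f t * indicator (space circle_measure) t \<partial>circle_measure) \<le> ennreal c * \<rho> f" by blast
  have c': "(\<integral>\<^sup>+t. f t \<partial>circle_measure) \<le> ennreal c * \<rho> f" if "f \<in> borel_measurable circle_measure" for f
  proof -
    have "(\<integral>\<^sup>+t. f t \<partial>circle_measure) = (\<integral>\<^sup>+t. f t * indicator (space circle_measure) t \<partial>circle_measure)"
      by (intro nn_integral_cong) auto
    then show ?thesis using c(2)[OF that] by simp
  qed
  \<comment> \<open>The constant in \<open>bounded_on_bfs\<close> may be negative, in which case
    \<open>ennreal C = 0\<close>; the maximum yields a nonnegative constant with the same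
    bound.\<close>
  interpret riesz_bounded_norm \<rho> "max 0 C" c
  proof
    fix f assume f: "f \<in> bfs \<rho>"
    show "riesz_projection f \<in> bfs \<rho>" using assms(2) f unfolding bounded_on_bfs_def by blast
    have "ennreal C \<le> ennreal (max 0 C)" by (intro ennreal_leI) auto
    then show "bfs_norm \<rho> (riesz_projection f) \<le> ennreal (max 0 C) * bfs_norm \<rho> f"
      by (rule order_trans[OF C[OF f] mult_right_mono]) simp
  qed (use assms(1) c(1) c' in auto)
  interpret assoc: abs_cont_circle_norm "associate_norm \<rho>" by (rule abs_cont_associate_norm)
  show ?thesis using abs_cont_part_eq assoc.abs_cont_part_eq by simp
qed

end
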